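(* Suppose $\min\{d_1,\dots,d_{L-1}\}\ge d_{\min}$, and: if $L=2$, $\lambda\ne y_i^2$ for all $i\in[r_Y]$; if $L\ge3$, $\lambda\ne y_i^{2(L-1)}\big((\tfrac{L-2}L)^{\frac{L}{2(L-1)}}+(\tfrac L{L-2})^{\frac{L-2}{2(L-1)}}\big)^{-2(L-1)}$ for all $i\in[r_Y]$. Then for every $\bm\sigma^*\in\mathcal A_{\rm sort}\setminus\{\bm0\}$ there exist constants $\epsilon_{\bm\sigma^*},\kappa_{\bm\sigma^*}>0$ (depending only on $L$, $\lambda$, $y_1,\dots,y_{d_{\min}}$, $d_0,\dots,d_L$ and $\bm\sigma^*$) such that for all $\bm W$ with $\mathrm{dist}(\bm W,\mathcal W_{\bm\sigma^*})\le\epsilon_{\bm\sigma^*}$, $$\mathrm{dist}(\bm W,\mathcal W_{\bm\sigma^*})\le\kappa_{\bm\sigma^*}\|\nabla G(\bm W)\|_F.$$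
   Context: Setting as in Lemma 3.5: $L\ge2$, $d_{\min}=\min\{d_0,d_L\}$, $\lambda>0$, $\bm Y\in\mathbb R^{d_L\times d_0}$ diagonal with entries $y_1\ge\dots\ge y_{d_{\min}}\ge0$, $r_Y$ the number of positive $y_i$; $G(\bm W)=\|\bm W_L\cdots\bm W_1-\sqrt\lambda\bm Y\|_F^2+\lambda\sum_l\|\bm W_l\|_F^2$ for $\bm W_l\in\mathbb R^{d_l\times d_{l-1}}$; $\mathcal A=\{\bm a\in\mathbb R^{d_{\min}}:a_i^{2L-1}-\sqrt\lambda y_ia_i^{L-1}+\lambda a_i=0,a_i\ge0\}$; $\mathcal A_{\rm sort}$ the set of nonincreasing rearrangements $\bm\sigma=\bm\Pi\bm a$ of elements $\bm a\in\mathcal A$; $\mathcal W_{\bm\sigma^*}$ the set of tuples $\bm W_1=\bm Q_2\bm\Sigma_1\mathrm{BlkD}(\bm\Pi,\bm I)\mathrm{BlkD}(\bm O_1,\dots,\bm O_{p_Y+1})$, $\bm W_l=\bm Q_{l+1}\bm\Sigma_l\bm Q_l^T$ ($2\le l\le L-1$), $\bm W_L=\mathrm{BlkD}(\bm O_1^T,\dots,\bm O_{p_Y}^T,\widehat{\bm O}_{p_Y+1}^T)\mathrm{BlkD}(\bm\Pi^T,\bm I)\bm\Sigma_L\bm Q_L^T$, where $\bm\Sigma_l\in\mathbb R^{d_l\times d_{l-1}}$ has top-left block $\mathrm{diag}(\bm\sigma^* )$, $\bm\Pi$ is a permutation with $\bm\Pi^T\bm\sigma^*\in\mathcal A$, and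 $\bm Q_l\in\mathcal O^{d_{l-1}}$, $\bm O_k\in\mathcal O^{h_k}$ ($h_k$ the multiplicities of the $p_Y$ distinct positive values among the $y_i$), $\bm O_{p_Y+1}\in\mathcal O^{d_0-r_Y}$, $\widehat{\bm O}_{p_Y+1}\in\mathcal O^{d_L-r_Y}$ range over all orthogonal matrices. Distances and gradient norms are Frobenius norms on tuples. *)

theory Defs
  imports "HOL-Analysis.Analysis"
begin

text \<open>Matrices are functions nat => nat => real; only entries within the stated
dimensions matter. A tuple W = (W_1,...,W_L) is a function
W :: nat => nat => nat => real with W l i j the (i,j) entry of W_l
(1 <= l <= L, i < d l, j < d (l-1)).\<close>

type_synonym mat = "nat \<Rightarrow> nat \<Rightarrow> real"

definition mmul :: "mat \<Rightarrow> mat \<Rightarrow> nat \<Rightarrow> mat" where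
  "mmul A B n = (\<lambda>i j. \<Sum>k<n. A i k * B k j)"

definition tr :: "mat \<Rightarrow> mat" where
  "tr A = (\<lambda>i j. A j i)"

definition orthogonal_mat :: "nat \<Rightarrow> mat \<Rightarrow> bool" where
  "orthogonal_mat n M \<longleftrightarrow>
     (\<forall>i<n. \<forall>j<n. (\<Sum>k<n. M k i * M k j) = (if i = j then 1 else 0))"

fun prodW :: "(nat \<Rightarrow> nat) \<Rightarrow> (nat \<Rightarrow> mat) \<Rightarrow> nat \<Rightarrow> mat" where
  "prodW d W 0 = (\<lambda>i j. if i = j then 1 else 0)"
| "prodW d W (Suc l) = mmul (W (Suc l)) (prodW d W l) (d l)"

definition dmin :: "(nat \<Rightarrow> nat) \<Rightarrow> nat \<Rightarrow> nat" where
  "dmin d L = min (d 0) (d L)"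

definition Ymat :: "(nat \<Rightarrow> nat) \<Rightarrow> nat \<Rightarrow> (nat \<Rightarrow> real) \<Rightarrow> mat" where
  "Ymat d L y = (\<lambda>i j. if i = j \<and> i < dmin d L then y i else 0)"

definition rY :: "(nat \<Rightarrow> nat) \<Rightarrow> nat \<Rightarrow> (nat \<Rightarrow> real) \<Rightarrow> nat" where
  "rY d L y = card {i. i < dmin d L \<and> y i > 0}"

definition idx :: "(nat \<Rightarrow> nat) \<Rightarrow> nat \<Rightarrow> (nat \<times> nat \<times> nat) set" where
  "idx d L = {(l, i, j). 1 \<le> l \<and> l \<le> L \<and> i < d l \<and> j < d (l - 1)}"

definition Gobj :: "(nat \<Rightarrow> nat) \<Rightarrow> nat \<Rightarrow> real \<Rightarrow> (nat \<Rightarrow> real) \<Rightarrow> (nat \<Rightarrow> mat) \<Rightarrow> real" where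
  "Gobj d L lam y W =
     (\<Sum>i<d L. \<Sum>j<d 0. (prodW d W L i j - sqrt lam * Ymat d L y i j)\<^sup>2)
     + lam * (\<Sum>(l, i, j)\<in>idx d L. (W l i j)\<^sup>2)"

definition partialG :: "(nat \<Rightarrow> nat) \<Rightarrow> nat \<Rightarrow> real \<Rightarrow> (nat \<Rightarrow> real) \<Rightarrow> (nat \<Rightarrow> mat)
     \<Rightarrow> nat \<Rightarrow> nat \<Rightarrow> nat \<Rightarrow> real" where
  "partialG d L lam y W l i j =
     deriv (\<lambda>t. Gobj d L lam y (W(l := (W l)(i := (W l i)(j := W l i j + t))))) 0"

definition gradG_norm :: "(nat \<Rightarrow> nat) \<Rightarrow> nat \<Rightarrow> real \<Rightarrow> (nat \<Rightarrow> real) \<Rightarrow> (nat \<Rightarrow> mat) \<Rightarrow> real" where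
  "gradG_norm d L lam y W = sqrt (\<Sum>(l, i, j)\<in>idx d L. (partialG d L lam y W l i j)\<^sup>2)"

definition frob_dist :: "(nat \<Rightarrow> nat) \<Rightarrow> nat \<Rightarrow> (nat \<Rightarrow> mat) \<Rightarrow> (nat \<Rightarrow> mat) \<Rightarrow> real" where
  "frob_dist d L W V = sqrt (\<Sum>(l, i, j)\<in>idx d L. (W l i j - V l i j)\<^sup>2)"

definition set_dist :: "(nat \<Rightarrow> nat) \<Rightarrow> nat \<Rightarrow> (nat \<Rightarrow> mat) \<Rightarrow> (nat \<Rightarrow> mat) set \<Rightarrow> real" where
  "set_dist d L W S = (INF V\<in>S. frob_dist d L W V)"

definition Aset :: "(nat \<Rightarrow> nat) \<Rightarrow> nat \<Rightarrow> real \<Rightarrow> (nat \<Rightarrow> real) \<Rightarrow> (nat \<Rightarrow> real) set" where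
  "Aset d L lam y = {a. \<forall>i<dmin d L.
      a i ^ (2 * L - 1) - sqrt lam * y i * a i ^ (L - 1) + lam * a i = 0 \<and> a i \<ge> 0}"

text \<open>Permutation matrix Pi of size n of the permutation p: Pi i j = 1 iff i = p j,
so that (Pi^T s) j = s (p j).\<close>
definition perm_mat :: "nat \<Rightarrow> (nat \<Rightarrow> nat) \<Rightarrow> mat" where
  "perm_mat n p = (\<lambda>i j. if i < n \<and> j < n \<and> i = p j then 1 else 0)"

definition blk_perm :: "nat \<Rightarrow> nat \<Rightarrow> (nat \<Rightarrow> nat) \<Rightarrow> mat" where
  "blk_perm m n p = (\<lambda>i j. if i < n \<and> j < n then perm_mat n p i j
                           else if i < m \<and> j < m \<and> i = j then 1 else 0)"

definition A_sort :: "(nat \<Rightarrow> nat) \<Rightarrow> nat \<Rightarrow> real \<Rightarrow> (nat \<Rightarrow> real) \<Rightarrow> (nat \<Rightarrow> real) set" where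
  "A_sort d L lam y = {s. (\<exists>a\<in>Aset d L lam y. \<exists>p. p permutes {..<dmin d L} \<and>
        (\<forall>i<dmin d L. s i = a (p i)))
      \<and> (\<forall>i j. i \<le> j \<and> j < dmin d L \<longrightarrow> s j \<le> s i)}"

definition Sigma_mat :: "nat \<Rightarrow> (nat \<Rightarrow> real) \<Rightarrow> mat" where
  "Sigma_mat n s = (\<lambda>i j. if i = j \<and> i < n then s i else 0)"

text \<open>Block pattern of BlkD(O_1,...,O_{p_Y}, O_{p_Y+1}) of size m: the first r rows/cols
are grouped into blocks of equal (positive) values of y, the remaining m - r form
one last block.\<close>
definition same_block :: "(nat \<Rightarrow> real) \<Rightarrow> nat \<Rightarrow> nat \<Rightarrow> nat \<Rightarrow> bool" where
  "same_block y r i j \<longleftrightarrow> (i < r \<and> j < r \<and> y i = y j) \<or> (r \<le> i \<and> r \<le> j)"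

definition blockdiag_orth :: "(nat \<Rightarrow> real) \<Rightarrow> nat \<Rightarrow> nat \<Rightarrow> mat \<Rightarrow> bool" where
  "blockdiag_orth y r m M \<longleftrightarrow> orthogonal_mat m M \<and>
     (\<forall>i<m. \<forall>j<m. \<not> same_block y r i j \<longrightarrow> M i j = 0)"

text \<open>The set W_{sigma*}. V = BlkD(O_1,...,O_{p_Y+1}) (size d_0),
U = BlkD(O_1^T,...,O_{p_Y}^T, hat O_{p_Y+1}^T) (size d_L), sharing the O_k.\<close>
definition Wset :: "(nat \<Rightarrow> nat) \<Rightarrow> nat \<Rightarrow> real \<Rightarrow> (nat \<Rightarrow> real) \<Rightarrow> (nat \<Rightarrow> real)
     \<Rightarrow> (nat \<Rightarrow> mat) set" where
  "Wset d L lam y s = {W. \<exists>p Q U V.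
      p permutes {..<dmin d L} \<and> (\<lambda>i. s (p i)) \<in> Aset d L lam y
    \<and> (\<forall>l\<in>{2..L}. orthogonal_mat (d (l - 1)) (Q l))
    \<and> blockdiag_orth y (rY d L y) (d 0) V
    \<and> blockdiag_orth y (rY d L y) (d L) U
    \<and> (\<forall>i<rY d L y. \<forall>j<rY d L y. U i j = V j i)
    \<and> (\<forall>i<d 1. \<forall>j<d 0. W 1 i j =
          mmul (mmul (mmul (Q 2) (Sigma_mat (dmin d L) s) (d 1))
                     (blk_perm (d 0) (dmin d L) p) (d 0)) V (d 0) i j)
    \<and> (\<forall>l\<in>{2..L-1}. \<forall>i<d l. \<forall>j<d (l - 1). W l i j =
          mmul (mmul (Q (l + 1)) (Sigma_mat (dmin d L) s) (d l)) (tr (Q l)) (d (l - 1)) i j)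
    \<and> (\<forall>i<d L. \<forall>j<d (L - 1). W L i j =
          mmul (mmul (mmul U (tr (blk_perm (d L) (dmin d L) p)) (d L))
                     (Sigma_mat (dmin d L) s) (d L)) (tr (Q L)) (d (L - 1)) i j)}"

end

theory Submission
  imports Defs
begin

text \<open>Every element of \<open>\<W>\<close> has the form \<open>W\<^sub>l = R\<^sub>l diag(a) R\<^sub>l\<^sub>-\<^sub>1\<^sup>T\<close> with \<open>a \<in> \<A>\<close> a permutation of
  \<open>\<sigma>\<^sup>*\<close>, where the orthogonal frames \<open>R\<close> range over a compact group that leaves the gradient norm
  invariant. So \<open>\<W>\<close> is a finite union of compact orbits, and after moving the nearest point to
  \<open>diag(a)\<close> the displacement is orthogonal to the orbit directions. The error bound then follows by
  compactness once the Hessian at \<open>diag(a)\<close> is injective on vectors orthogonal to the orbit. For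
  diagonal \<open>a\<close> the Hessian equations decouple into pairs of entries \<open>(i, j)\<close>, \<open>(j, i)\<close> over all layers;
  balancedness makes each family geometric in the layer index, which leaves a symmetric two-by-two
  system. Its determinant vanishes only if \<open>y\<^sub>i = y\<^sub>j\<close> (a rotation of the outer layers) or at a double root
  of the equation defining \<open>\<A>\<close>, and the latter is what the assumption on \<open>\<lambda>\<close> excludes.\<close>

section \<open>Matrices and the gradient\<close>

text \<open>Points near \<open>diag(b)\<close> are not critical, so they are balanced only
  approximately: an identity expresses \<open>W_{l+1}^T W_{l+1} - W_l W_l^T\<close> through the
  gradient, and a gradient of order \<open>o(t)\<close> at distance \<open>t\<close> makes the limit
  direction \<open>X\<close> satisfy the linearized balance equation. This is the symmetric half of
  a relation between consecutive layers; orthogonality to the hidden rotations is the antisymmetric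
  half. Together they give \<open>b i * X (l+1) i j = b j * X l i j\<close>, the source of the
  geometric families. The Hessian is never formed: first-order expansions along a sequence take its
  place.

  The condition on \<open>lam\<close> concerns
  \<open>f(a) = a^(2L-1) - sqrt lam y a^(L-1) + lam a\<close>. At a positive root,
  \<open>f'(a) = L a^(2L-2) - lam (L-2)\<close>. For \<open>L = 2\<close> this is positive, and the
  only possible multiple root is \<open>a = 0\<close>, which occurs iff
  \<open>sqrt lam y = lam\<close>. For \<open>L >= 3\<close> the root \<open>a = 0\<close> is simple
  because \<open>f'(0) = lam\<close>, and eliminating a positive \<open>a\<close> from
  \<open>f = f' = 0\<close> gives the excluded value of \<open>lam\<close>.\<close>

definition idm :: mat where "idm = (\<lambda>i j. if i = j then 1 else 0)"

lemma mmul_assoc: "mmul (mmul A B n) C m = mmul A (mmul B C m) n"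
proof (intro ext)
  fix i j
  have "(\<Sum>k<m. (\<Sum>l<n. A i l * B l k) * C k j) = (\<Sum>k<m. \<Sum>l<n. A i l * (B l k * C k j))"
    by (simp add: sum_distrib_right mult.assoc)
  also have "\<dots> = (\<Sum>l<n. \<Sum>k<m. A i l * (B l k * C k j))" by (rule sum.swap)
  finally show "mmul (mmul A B n) C m i j = mmul A (mmul B C m) n i j"
    by (simp add: mmul_def sum_distrib_left)
qed

lemma tr_mmul: "tr (mmul A B n) = mmul (tr B) (tr A) n"
  by (simp add: tr_def mmul_def mult.commute)

lemma tr_tr [simp]: "tr (tr A) = A"
  by (simp add: tr_def)

lemma tr_idm [simp]: "tr idm = idm"
  by (auto simp: tr_def idm_def fun_eq_iff)

lemma mmul_cong:
  assumes "\<And>k. k < n \<Longrightarrow> A i k = A' i k" "\<And>k. k < n \<Longrightarrow> B k j = B' k j"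
  shows "mmul A B n i j = mmul A' B' n i j"
  using assms by (simp add: mmul_def)

lemma mmul_idm_left: "i < n \<Longrightarrow> mmul idm A n i j = A i j"
  by (simp add: mmul_def idm_def of_bool_def if_distrib[of "\<lambda>x. x * _"] sum.delta cong: if_cong)

lemma mmul_idm_right: "j < n \<Longrightarrow> mmul A idm n i j = A i j"
  by (simp add: mmul_def idm_def of_bool_def if_distrib[of "\<lambda>x. _ * x"] sum.delta cong: if_cong)

definition frob2 :: "nat \<Rightarrow> nat \<Rightarrow> mat \<Rightarrow> real" where
  "frob2 m n M = (\<Sum>i<m. \<Sum>j<n. (M i j)\<^sup>2)"

lemma frob2_cong:
  assumes "\<And>i j. i < m \<Longrightarrow> j < n \<Longrightarrow> A i j = B i j"
  shows "frob2 m n A = frob2 m n B"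
  using assms by (simp add: frob2_def)

lemma frob2_tr: "frob2 n m (tr M) = frob2 m n M"
  unfolding frob2_def tr_def by (rule sum.swap)

lemma orthogonal_mat_iff:
  "orthogonal_mat n M \<longleftrightarrow> (\<forall>i<n. \<forall>j<n. mmul (tr M) M n i j = idm i j)"
  by (simp add: orthogonal_mat_def mmul_def tr_def idm_def)

lemma mmul_orth_left:
  assumes "orthogonal_mat n M" "i < n"
  shows "mmul (tr M) (mmul M B n) n i j = B i j"
proof -
  have "mmul (tr M) (mmul M B n) n i j = mmul (mmul (tr M) M n) B n i j"
    by (simp add: mmul_assoc)
  also have "\<dots> = mmul idm B n i j"
    by (rule mmul_cong) (use assms in \<open>auto simp: orthogonal_mat_iff\<close>)
  finally show ?thesis using assms(2) by (simp add: mmul_idm_left)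
qed

text \<open>Since \<open>M\<^sup>T M = I\<close>, the matrix \<open>M M\<^sup>T\<close> is a symmetric idempotent of trace \<open>n\<close>,
  hence \<open>\<parallel>I - M M\<^sup>T\<parallel>\<^sup>2 = 0\<close>.\<close>
lemma orthogonal_mat_tr:
  assumes "orthogonal_mat n M"
  shows "orthogonal_mat n (tr M)"
proof -
  define K where "K = mmul M (tr M) n"
  have MM: "(\<Sum>k<n. M k i * M k j) = idm i j" if "i < n" "j < n" for i j
    using assms that by (simp add: orthogonal_mat_def idm_def)
  have KK: "mmul K K n = K"
  proof -
    have "mmul K K n = mmul M (mmul (tr M) (mmul M (tr M) n) n) n"
      by (simp add: K_def mmul_assoc)
    also have "\<dots> = mmul M (tr M) n"
      by (intro ext mmul_cong) (auto simp: mmul_orth_left[OF assms])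
    finally show ?thesis by (simp add: K_def)
  qed
  have Ksym: "K i j = K j i" for i j
    by (simp add: K_def mmul_def tr_def mult.commute)
  have trace: "(\<Sum>i<n. K i i) = n"
  proof -
    have "(\<Sum>i<n. K i i) = (\<Sum>i<n. \<Sum>k<n. M i k * M i k)"
      by (simp add: K_def mmul_def tr_def)
    also have "\<dots> = (\<Sum>k<n. \<Sum>i<n. M i k * M i k)" by (rule sum.swap)
    also have "\<dots> = (\<Sum>k<n. 1)" by (rule sum.cong) (auto simp: MM idm_def)
    finally show ?thesis by simp
  qed
  have row: "(\<Sum>j<n. (idm i j - K i j)\<^sup>2) = 1 - K i i" if "i < n" for i
  proof -
    have "(\<Sum>j<n. (idm i j - K i j)\<^sup>2)
        = (\<Sum>j<n. (if i = j then 1 - 2 * K i i else 0) + K i j * K j i)"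
      by (rule sum.cong) (auto simp: idm_def power2_eq_square algebra_simps Ksym)
    also have "\<dots> = 1 - 2 * K i i + mmul K K n i i"
      using that by (simp add: sum.distrib mmul_def)
    finally show ?thesis by (simp add: KK)
  qed
  have "frob2 n n (\<lambda>i j. idm i j - K i j) = 0"
    by (simp add: frob2_def row sum_subtractf trace)
  then have "\<forall>i<n. \<forall>j<n. (idm i j - K i j)\<^sup>2 = 0"
    unfolding frob2_def
    by (simp add: sum_nonneg_eq_0_iff sum_nonneg)
  then show ?thesis
    by (simp add: orthogonal_mat_iff K_def)
qed

lemma mmul_orth_right:
  assumes "orthogonal_mat n M" "i < n"
  shows "mmul M (mmul (tr M) B n) n i j = B i j"
  using mmul_orth_left[OF orthogonal_mat_tr[OF assms(1)] assms(2)] by simp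

text \<open>Under an outer product the inner row index is summed over \<open>k < n\<close>, so the
  range condition of \<open>mmul_orth_left\<close> disappears. In this unconditional form the
  cancellation serves as a rewrite rule once \<open>mmul_assoc\<close> has moved all brackets to the
  right.\<close>

lemma mmul_orth_cancel:
  assumes "orthogonal_mat n M"
  shows "mmul A (mmul (tr M) (mmul M B n) n) n = mmul A B n"
    and "mmul A (mmul M (mmul (tr M) B n) n) n = mmul A B n"
  by (intro ext mmul_cong; simp add: mmul_orth_left mmul_orth_right assms)+

lemma mmul_orth_id:
  assumes "orthogonal_mat n M" "i < n" "j < n"
  shows "mmul M (tr M) n i j = idm i j" "mmul (tr M) M n i j = idm i j"
  using assms orthogonal_mat_tr[OF assms(1)] by (auto simp: orthogonal_mat_iff)

lemma orthogonal_mat_mmul: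
  assumes "orthogonal_mat n A" "orthogonal_mat n B"
  shows "orthogonal_mat n (mmul A B n)"
  using assms unfolding orthogonal_mat_iff[of n "mmul A B n"]
  by (simp add: tr_mmul mmul_assoc mmul_orth_cancel mmul_orth_id)

lemma frob2_mmul_left:
  assumes "orthogonal_mat m S"
  shows "frob2 m n (mmul S M m) = frob2 m n M"
proof -
  have *: "(\<Sum>i<m. (mmul S M m i j)\<^sup>2) = (\<Sum>i<m. (M i j)\<^sup>2)" for j
  proof -
    have "(\<Sum>i<m. (mmul S M m i j)\<^sup>2) = mmul (tr (mmul S M m)) (mmul S M m) m j j"
      by (simp add: mmul_def tr_def power2_eq_square)
    also have "\<dots> = mmul (tr M) M m j j"
      by (simp add: tr_mmul mmul_assoc mmul_orth_cancel assms)
    finally show ?thesis by (simp add: mmul_def tr_def power2_eq_square)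
  qed
  show ?thesis
    using sum.swap[of "\<lambda>i j. (mmul S M m i j)\<^sup>2" "{..<n}" "{..<m}"]
      sum.swap[of "\<lambda>i j. (M i j)\<^sup>2" "{..<n}" "{..<m}"]
    by (simp add: frob2_def *)
qed

lemma frob2_mmul_right:
  assumes "orthogonal_mat n S"
  shows "frob2 m n (mmul M (tr S) n) = frob2 m n M"
  using frob2_mmul_left[OF assms, of m "tr M"] frob2_tr[of n m "mmul M (tr S) n"] frob2_tr[of n m M]
  by (simp add: tr_mmul)

lemma sum_idx: "(\<Sum>(l, i, j)\<in>idx d L. f l i j) = (\<Sum>l=1..L. \<Sum>i<d l. \<Sum>j<d (l - 1). f l i j)"
proof -
  have "idx d L = Sigma {1..L} (\<lambda>l. {..<d l} \<times> {..<d (l - 1)})"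
    by (auto simp: idx_def)
  then have "(\<Sum>(l, i, j)\<in>idx d L. f l i j)
      = (\<Sum>l=1..L. \<Sum>(i, j)\<in>{..<d l} \<times> {..<d (l - 1)}. f l i j)"
    by (subst sum.Sigma) auto
  then show ?thesis
    by (simp add: sum.cartesian_product)
qed

lemma finite_idx: "finite (idx d L)"
proof -
  have "idx d L = Sigma {1..L} (\<lambda>l. {..<d l} \<times> {..<d (l - 1)})"
    by (auto simp: idx_def)
  then show ?thesis by simp
qed

lemma frob_dist_frob2:
  "frob_dist d L W V = sqrt (\<Sum>l=1..L. frob2 (d l) (d (l - 1)) (\<lambda>i j. W l i j - V l i j))"
  by (simp add: frob_dist_def sum_idx frob2_def)

section \<open>Partial products and the gradient in matrix form\<close>

lemma prodW_cong:
  assumes "\<And>l. 1 \<le> l \<Longrightarrow> l \<le> k \<Longrightarrow> W l = W' l"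
  shows "prodW d W k = prodW d W' k"
  using assms by (induction k) auto

text \<open>The product \<open>W_L ... W_{l+1}\<close>, encoded as \<open>prodW\<close> of the
  network shifted by \<open>l\<close>, so that every fact about \<open>prodW\<close> also applies to
  it.\<close>

abbreviation prodL :: "(nat \<Rightarrow> nat) \<Rightarrow> (nat \<Rightarrow> mat) \<Rightarrow> nat \<Rightarrow> nat \<Rightarrow> mat" where
  "prodL d W L l \<equiv> prodW (\<lambda>k. d (k + l)) (\<lambda>k. W (k + l)) (L - l)"

lemma prodW_split:
  "i < d (k + l) \<Longrightarrow>
    prodW d W (k + l) i j = mmul (prodW (\<lambda>k. d (k + l)) (\<lambda>k. W (k + l)) k) (prodW d W l) (d l) i j"
proof (induction k arbitrary: i)
  case 0
  then show ?case by (simp add: mmul_idm_left[unfolded idm_def])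
next
  case (Suc k)
  have "prodW d W (Suc k + l) i j = mmul (W (Suc (k + l))) (prodW d W (k + l)) (d (k + l)) i j"
    by simp
  also have "\<dots> = mmul (W (Suc (k + l)))
       (mmul (prodW (\<lambda>k. d (k + l)) (\<lambda>k. W (k + l)) k) (prodW d W l) (d l)) (d (k + l)) i j"
    by (rule mmul_cong) (auto simp: Suc.IH)
  finally show ?case by (simp add: mmul_assoc)
qed

lemma prodW_split':
  assumes "1 \<le> l" "l \<le> L" "i < d L"
  shows "prodW d W L i j
    = mmul (prodL d W L l) (mmul (W l) (prodW d W (l - 1)) (d (l - 1))) (d l) i j"
proof -
  have "prodW d W l = mmul (W l) (prodW d W (l - 1)) (d (l - 1))"
    using assms(1) by (cases l) auto
  then show ?thesis
    using prodW_split[of i d "L - l" l W j] assms by simp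
qed

text \<open>\<open>prodW\<close> recurses at its leftmost factor. The rightmost factor is reached
  through \<open>prodW_split\<close> with a lower part of length one.\<close>

lemma prodL_rec:
  assumes "l < L" "i < d L" "j < d l"
  shows "prodL d W L l i j = mmul (prodL d W L (Suc l)) (W (Suc l)) (d (Suc l)) i j"
proof -
  have "prodW (\<lambda>k. d (k + l)) (\<lambda>k. W (k + l)) ((L - Suc l) + 1) i j
     = mmul (prodW (\<lambda>k. d (k + 1 + l)) (\<lambda>k. W (k + 1 + l)) (L - Suc l))
         (prodW (\<lambda>k. d (k + l)) (\<lambda>k. W (k + l)) 1) (d (1 + l)) i j"
    by (rule prodW_split) (use assms in simp)
  moreover have "L - Suc l + 1 = L - l" using assms by simp
  moreover have "mmul A (prodW (\<lambda>k. d (k + l)) (\<lambda>k. W (k + l)) 1) (d (1 + l)) i j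
      = mmul A (W (Suc l)) (d (Suc l)) i j" for A
    by (simp, rule mmul_cong)
      (use assms in \<open>auto simp: mmul_idm_right[unfolded idm_def]\<close>)
  ultimately show ?thesis by (simp only: add.assoc plus_1_eq_Suc add_Suc_right add_Suc add_0)
qed

definition resid :: "(nat \<Rightarrow> nat) \<Rightarrow> nat \<Rightarrow> real \<Rightarrow> (nat \<Rightarrow> real) \<Rightarrow> (nat \<Rightarrow> mat) \<Rightarrow> mat" where
  "resid d L lam y W = (\<lambda>i j. prodW d W L i j - sqrt lam * Ymat d L y i j)"

text \<open>Half of the gradient in layer \<open>l\<close>, namely
  \<open>A^T E B^T + lam W_l\<close> with the residual \<open>E\<close>,
  \<open>A = W_L ... W_{l+1}\<close> and \<open>B = W_{l-1} ... W_1\<close>.\<close>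

definition hgrad :: "(nat \<Rightarrow> nat) \<Rightarrow> nat \<Rightarrow> real \<Rightarrow> (nat \<Rightarrow> real) \<Rightarrow> (nat \<Rightarrow> mat) \<Rightarrow> nat \<Rightarrow> mat" where
  "hgrad d L lam y W l = (\<lambda>i j.
     mmul (tr (prodL d W L l)) (mmul (resid d L lam y W) (tr (prodW d W (l - 1))) (d 0)) (d L) i j
     + lam * W l i j)"

text \<open>The product is affine in each single layer: changing one entry of \<open>W_l\<close> by
  \<open>t\<close> adds \<open>t\<close> times the rank-one matrix (column \<open>i\<close> of
  \<open>A\<close>) times (row \<open>j\<close> of \<open>B\<close>).\<close>

lemma prodW_update:
  assumes "1 \<le> l" "l \<le> L" "i < d l" "j < d (l - 1)" "a < d L"
  shows "prodW d (W(l := (W l)(i := (W l i)(j := W l i j + t)))) L a b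
    = prodW d W L a b + t * (prodL d W L l a i * prodW d W (l - 1) j b)"
proof -
  define M where "M = (W l)(i := (W l i)(j := W l i j + t))"
  have upd: "prodL d (W(l := M)) L l = prodL d W L l"
    "prodW d (W(l := M)) (l - 1) = prodW d W (l - 1)"
    by (rule prodW_cong; use assms in auto)+
  have Mrow: "M k k' = W l k k' + (if k = i then (if k' = j then t else 0) else 0)" for k k'
    by (simp add: M_def)
  have inner: "mmul M (prodW d W (l - 1)) (d (l - 1)) k b
      = mmul (W l) (prodW d W (l - 1)) (d (l - 1)) k b + (if k = i then t * prodW d W (l - 1) j b else 0)"
    for k
    using assms(4)
    by (simp add: mmul_def Mrow distrib_right sum.distrib if_distrib[of "\<lambda>x. x * _"] cong: if_cong)
  have "prodW d (W(l := M)) L a b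
     = mmul (prodL d W L l) (mmul M (prodW d W (l - 1)) (d (l - 1))) (d l) a b"
    using prodW_split'[of l L a d "W(l := M)" b, OF assms(1,2,5)] by (simp only: upd fun_upd_same)
  also have "\<dots> = mmul (prodL d W L l) (mmul (W l) (prodW d W (l - 1)) (d (l - 1))) (d l) a b
       + prodL d W L l a i * (t * prodW d W (l - 1) j b)"
    unfolding mmul_def[of "prodL d W L l"] inner using assms(3)
    by (simp add: distrib_left sum.distrib if_distrib[of "\<lambda>x. _ * x"] cong: if_cong)
  finally show ?thesis
    using prodW_split'[of l L a d W b, OF assms(1,2,5)] by (simp add: M_def mult_ac)
qed

lemma partialG_eq:
  assumes "1 \<le> l" "l \<le> L" "i < d l" "j < d (l - 1)"
  shows "partialG d L lam y W l i j = 2 * hgrad d L lam y W l i j"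
proof -
  define V where "V = (\<lambda>t. W(l := (W l)(i := (W l i)(j := W l i j + t))))"
  define c where "c = (\<lambda>a b. prodL d W L l a i * prodW d W (l - 1) j b)"
  have res: "((\<lambda>t. \<Sum>a<d L. \<Sum>b<d 0. (prodW d (V t) L a b - sqrt lam * Ymat d L y a b)\<^sup>2)
     has_real_derivative (\<Sum>a<d L. \<Sum>b<d 0. 2 * resid d L lam y W a b * c a b)) (at 0)"
  proof (intro DERIV_sum)
    fix a b assume ab: "a \<in> {..<d L}" "b \<in> {..<d 0}"
    have "prodW d (V t) L a b = prodW d W L a b + t * c a b" for t
      using prodW_update[OF assms, of a W t b] ab by (simp add: V_def c_def)
    then show "((\<lambda>t. (prodW d (V t) L a b - sqrt lam * Ymat d L y a b)\<^sup>2)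
       has_real_derivative 2 * resid d L lam y W a b * c a b) (at 0)"
      by (auto intro!: derivative_eq_intros simp: resid_def)
  qed
  have reg: "((\<lambda>t. \<Sum>(l', i', j')\<in>idx d L. (V t l' i' j')\<^sup>2)
     has_real_derivative (\<Sum>x\<in>idx d L. if x = (l, i, j) then 2 * W l i j else 0)) (at 0)"
    unfolding split_def
  proof (intro DERIV_sum)
    fix x assume "x \<in> idx d L"
    have "V t (fst x) (fst (snd x)) (snd (snd x))
       = W (fst x) (fst (snd x)) (snd (snd x)) + (if x = (l, i, j) then t else 0)" for t
      by (cases x) (auto simp: V_def)
    then show "((\<lambda>t. (V t (fst x) (fst (snd x)) (snd (snd x)))\<^sup>2)
       has_real_derivative (if x = (l, i, j) then 2 * W l i j else 0)) (at 0)"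
      by (cases "x = (l, i, j)") (auto intro!: derivative_eq_intros)
  qed
  have "(l, i, j) \<in> idx d L" using assms by (simp add: idx_def)
  then have regv: "(\<Sum>x\<in>idx d L. if x = (l, i, j) then 2 * W l i j else 0) = 2 * W l i j"
    by (simp add: finite_idx)
  have "((\<lambda>t. Gobj d L lam y (V t)) has_real_derivative
     (\<Sum>a<d L. \<Sum>b<d 0. 2 * resid d L lam y W a b * c a b) + lam * (2 * W l i j)) (at 0)"
    unfolding Gobj_def using DERIV_add[OF res DERIV_cmult[OF reg, of lam]] by (simp add: regv)
  then have "partialG d L lam y W l i j
     = (\<Sum>a<d L. \<Sum>b<d 0. 2 * resid d L lam y W a b * c a b) + lam * (2 * W l i j)"
    unfolding partialG_def V_def by (rule DERIV_imp_deriv)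
  also have "(\<Sum>a<d L. \<Sum>b<d 0. 2 * resid d L lam y W a b * c a b)
     = 2 * mmul (tr (prodL d W L l)) (mmul (resid d L lam y W) (tr (prodW d W (l - 1))) (d 0)) (d L) i j"
    by (simp add: mmul_def tr_def c_def sum_distrib_left mult_ac)
  finally show ?thesis by (simp add: hgrad_def algebra_simps)
qed

lemma gradG_norm_eq:
  "gradG_norm d L lam y W = 2 * sqrt (\<Sum>l=1..L. frob2 (d l) (d (l - 1)) (hgrad d L lam y W l))"
proof -
  have "(\<Sum>(l, i, j)\<in>idx d L. (partialG d L lam y W l i j)\<^sup>2)
      = (\<Sum>(l, i, j)\<in>idx d L. 4 * (hgrad d L lam y W l i j)\<^sup>2)"
    by (rule sum.cong) (auto simp: idx_def partialG_eq)
  also have "\<dots> = 4 * (\<Sum>l=1..L. frob2 (d l) (d (l - 1)) (hgrad d L lam y W l))"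
    by (simp add: sum_idx frob2_def sum_distrib_left)
  finally show ?thesis
    by (simp add: gradG_norm_def real_sqrt_mult)
qed

section \<open>Orthogonal invariance\<close>

text \<open>A change of orthonormal basis in every layer space, \<open>W_l\<close> becoming
  \<open>S_l W_l S_{l-1}^T\<close>. In products of consecutive layers the inner factors cancel, so
  only the outermost two remain.\<close>

definition act :: "(nat \<Rightarrow> nat) \<Rightarrow> (nat \<Rightarrow> mat) \<Rightarrow> (nat \<Rightarrow> mat) \<Rightarrow> nat \<Rightarrow> mat" where
  "act d S W l = mmul (S l) (mmul (W l) (tr (S (l - 1))) (d (l - 1))) (d l)"

lemma act_Suc: "act d S W (Suc l) = mmul (S (Suc l)) (mmul (W (Suc l)) (tr (S l)) (d l)) (d (Suc l))"
  by (simp add: act_def)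

lemma act_act: "act d S (act d T W) = act d (\<lambda>l. mmul (S l) (T l) (d l)) W"
  by (simp add: fun_eq_iff act_def tr_mmul mmul_assoc)

lemma mmul_diff_left: "mmul (\<lambda>i j. A i j - B i j) C n = (\<lambda>i j. mmul A C n i j - mmul B C n i j)"
  by (simp add: mmul_def left_diff_distrib sum_subtractf)

lemma mmul_diff_right: "mmul A (\<lambda>i j. B i j - C i j) n = (\<lambda>i j. mmul A B n i j - mmul A C n i j)"
  by (simp add: mmul_def right_diff_distrib sum_subtractf)

lemma mmul_add_left: "mmul (\<lambda>i j. A i j + B i j) C n = (\<lambda>i j. mmul A C n i j + mmul B C n i j)"
  by (simp add: mmul_def distrib_right sum.distrib)

lemma mmul_add_right: "mmul A (\<lambda>i j. B i j + C i j) n = (\<lambda>i j. mmul A B n i j + mmul A C n i j)"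
  by (simp add: mmul_def distrib_left sum.distrib)

lemma mmul_scale_left: "mmul (\<lambda>i j. c * A i j) B n = (\<lambda>i j. c * mmul A B n i j)"
  by (simp add: mmul_def sum_distrib_left mult_ac)

lemma mmul_scale_right: "mmul A (\<lambda>i j. c * B i j) n = (\<lambda>i j. c * mmul A B n i j)"
  by (simp add: mmul_def sum_distrib_left mult_ac)

lemma frob_dist_cong:
  assumes "\<And>l i j. 1 \<le> l \<Longrightarrow> l \<le> L \<Longrightarrow> i < d l \<Longrightarrow> j < d (l - 1) \<Longrightarrow> W l i j = W' l i j"
    and "\<And>l i j. 1 \<le> l \<Longrightarrow> l \<le> L \<Longrightarrow> i < d l \<Longrightarrow> j < d (l - 1) \<Longrightarrow> V l i j = V' l i j"
  shows "frob_dist d L W V = frob_dist d L W' V'"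
  unfolding frob_dist_def
  by (rule arg_cong[where f = sqrt], rule sum.cong) (auto simp: idx_def assms)

lemma frob2_sandwich:
  assumes "orthogonal_mat m S" "orthogonal_mat n T"
  shows "frob2 m n (mmul S (mmul M (tr T) n) m) = frob2 m n M"
  by (simp add: frob2_mmul_left frob2_mmul_right assms)

lemma frob_dist_act:
  assumes "\<And>l. l \<le> L \<Longrightarrow> orthogonal_mat (d l) (S l)"
  shows "frob_dist d L (act d S W) (act d S V) = frob_dist d L W V"
proof -
  have "frob2 (d l) (d (l - 1)) (\<lambda>i j. act d S W l i j - act d S V l i j)
      = frob2 (d l) (d (l - 1)) (\<lambda>i j. W l i j - V l i j)" if "l \<in> {1..L}" for l
  proof -
    have "(\<lambda>i j. act d S W l i j - act d S V l i j)
       = mmul (S l) (mmul (\<lambda>i j. W l i j - V l i j) (tr (S (l - 1))) (d (l - 1))) (d l)"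
      by (simp add: act_def mmul_diff_left mmul_diff_right)
    moreover have "orthogonal_mat (d l) (S l)" "orthogonal_mat (d (l - 1)) (S (l - 1))"
      using that by (auto intro!: assms)
    ultimately show ?thesis
      by (simp only: frob2_sandwich)
  qed
  then show ?thesis by (simp add: frob_dist_frob2)
qed

lemma act_orth_inverse:
  assumes "\<And>l. l \<le> L \<Longrightarrow> orthogonal_mat (d l) (S l)"
    and "1 \<le> l" "l \<le> L" "i < d l" "j < d (l - 1)"
  shows "act d (\<lambda>l. tr (S l)) (act d S W) l i j = W l i j"
proof -
  have "act d (\<lambda>l. tr (S l)) (act d S W) l i j
     = mmul (tr (S l)) (mmul (S l) (mmul (W l) (mmul (tr (S (l - 1))) (S (l - 1)) (d (l - 1))) (d (l - 1))) (d l)) (d l) i j"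
    by (simp add: act_def mmul_assoc)
  also have "\<dots> = mmul (W l) (mmul (tr (S (l - 1))) (S (l - 1)) (d (l - 1))) (d (l - 1)) i j"
    by (rule mmul_orth_left) (use assms in auto)
  also have "\<dots> = mmul (W l) idm (d (l - 1)) i j"
    by (rule mmul_cong) (use assms in \<open>auto simp: mmul_orth_id\<close>)
  finally show ?thesis using assms by (simp add: mmul_idm_right)
qed

lemma prodW_act:
  assumes "\<And>l. l \<le> k \<Longrightarrow> orthogonal_mat (d l) (S l)" "i < d k" "j < d 0"
  shows "prodW d (act d S W) k i j
    = mmul (S k) (mmul (prodW d W k) (tr (S 0)) (d 0)) (d k) i j"
  using assms
proof (induction k arbitrary: i)
  case 0
  have "mmul (S 0) (mmul idm (tr (S 0)) (d 0)) (d 0) i j = mmul (S 0) (tr (S 0)) (d 0) i j"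
    by (rule mmul_cong) (auto simp: mmul_idm_left)
  then show ?case using 0 mmul_orth_id[of "d 0" "S 0" i j] by (simp add: idm_def)
next
  case (Suc k)
  have "prodW d (act d S W) (Suc k) i j
     = mmul (act d S W (Suc k)) (mmul (S k) (mmul (prodW d W k) (tr (S 0)) (d 0)) (d k)) (d k) i j"
    by (simp, rule mmul_cong) (use Suc in auto)
  then show ?case
    using Suc.prems(1)[of k] by (simp add: act_Suc mmul_assoc mmul_orth_cancel)
qed

lemma prodL_act:
  assumes "\<And>l. l \<le> L \<Longrightarrow> orthogonal_mat (d l) (S l)" "l \<le> L" "i < d L" "j < d l"
  shows "prodL d (act d S W) L l i j
    = mmul (S L) (mmul (prodL d W L l) (tr (S l)) (d l)) (d L) i j"
proof -
  have 1: "prodL d (act d S W) L l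
     = prodW (\<lambda>k. d (k + l)) (act (\<lambda>k. d (k + l)) (\<lambda>k. S (k + l)) (\<lambda>k. W (k + l))) (L - l)"
    by (rule prodW_cong) (simp add: act_def)
  have "prodW (\<lambda>k. d (k + l)) (act (\<lambda>k. d (k + l)) (\<lambda>k. S (k + l)) (\<lambda>k. W (k + l))) (L - l) i j
    = mmul (S (L - l + l)) (mmul (prodL d W L l) (tr (S (0 + l))) (d (0 + l))) (d (L - l + l)) i j"
    by (rule prodW_act) (use assms(2-4) in \<open>auto intro!: assms(1)\<close>)
  then show ?thesis using assms(2) by (simp add: 1)
qed

lemma tr_apply: "tr A i j = A j i"
  by (simp add: tr_def)

lemma mmul_cong3:
  assumes "\<And>a. a < m \<Longrightarrow> A i a = A' i a" "\<And>a b. a < m \<Longrightarrow> b < n \<Longrightarrow> B a b = B' a b"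
    "\<And>b. b < n \<Longrightarrow> C b j = C' b j"
  shows "mmul A (mmul B C n) m i j = mmul A' (mmul B' C' n) m i j"
  by (intro mmul_cong assms)

context
  fixes d :: "nat \<Rightarrow> nat" and L :: nat and lam :: real and y :: "nat \<Rightarrow> real" and S :: "nat \<Rightarrow> mat"
  assumes orthS: "\<And>l. l \<le> L \<Longrightarrow> orthogonal_mat (d l) (S l)"
    and fixY: "\<And>i j. i < d L \<Longrightarrow> j < d 0 \<Longrightarrow>
      mmul (S L) (mmul (Ymat d L y) (tr (S 0)) (d 0)) (d L) i j = Ymat d L y i j"
begin

lemma resid_act:
  assumes "i < d L" "j < d 0"
  shows "resid d L lam y (act d S W) i j
    = mmul (S L) (mmul (resid d L lam y W) (tr (S 0)) (d 0)) (d L) i j"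
proof -
  have 1: "prodW d (act d S W) L i j = mmul (S L) (mmul (prodW d W L) (tr (S 0)) (d 0)) (d L) i j"
    by (rule prodW_act[OF orthS assms])
  have 2: "mmul (resid d L lam y W) T n
      = (\<lambda>i j. mmul (prodW d W L) T n i j - sqrt lam * mmul (Ymat d L y) T n i j)" for T n
    unfolding resid_def mmul_diff_left mmul_scale_left ..
  have 3: "mmul A (\<lambda>i j. B i j - sqrt lam * C i j) n i j
     = mmul A B n i j - sqrt lam * mmul A C n i j" for A B C n
    unfolding mmul_diff_right mmul_scale_right ..
  show ?thesis
    unfolding 2 3 fixY[OF assms] 1[symmetric] by (simp add: resid_def)
qed

text \<open>As \<open>Y\<close> is fixed, the residual becomes \<open>S_L E S_0^T\<close>. In
  \<open>A^T E B^T\<close> the factors \<open>S_L\<close> and \<open>S_0\<close> then cancel against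
  those of \<open>A\<close> and \<open>B\<close>, leaving \<open>S_l\<close> on the left and
  \<open>S_{l-1}^T\<close> on the right.\<close>

lemma hgrad_act:
  assumes "1 \<le> l" "l \<le> L" "i < d l" "j < d (l - 1)"
  shows "hgrad d L lam y (act d S W) l i j
    = mmul (S l) (mmul (hgrad d L lam y W l) (tr (S (l - 1))) (d (l - 1))) (d l) i j"
proof -
  let ?A = "prodL d W L l" and ?B = "prodW d W (l - 1)" and ?R = "resid d L lam y W"
  have "mmul (tr (prodL d (act d S W) L l))
      (mmul (resid d L lam y (act d S W)) (tr (prodW d (act d S W) (l - 1))) (d 0)) (d L) i j
    = mmul (tr (mmul (S L) (mmul ?A (tr (S l)) (d l)) (d L)))
      (mmul (mmul (S L) (mmul ?R (tr (S 0)) (d 0)) (d L))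
        (tr (mmul (S (l - 1)) (mmul ?B (tr (S 0)) (d 0)) (d (l - 1)))) (d 0)) (d L) i j"
  proof (rule mmul_cong3)
    fix a assume "a < d L"
    then have "prodL d (act d S W) L l a i = mmul (S L) (mmul ?A (tr (S l)) (d l)) (d L) a i"
      using assms(2,3) by (auto intro!: prodL_act orthS)
    then show "tr (prodL d (act d S W) L l) i a = tr (mmul (S L) (mmul ?A (tr (S l)) (d l)) (d L)) i a"
      unfolding tr_apply[of _ i a] .
  next
    fix a b assume "a < d L" "b < d 0"
    then show "resid d L lam y (act d S W) a b = mmul (S L) (mmul ?R (tr (S 0)) (d 0)) (d L) a b"
      by (rule resid_act)
  next
    fix b assume "b < d 0"
    have "orthogonal_mat (d k) (S k)" if "k \<le> l - 1" for k
      by (rule orthS) (use that assms in linarith)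
    then have "prodW d (act d S W) (l - 1) j b
        = mmul (S (l - 1)) (mmul ?B (tr (S 0)) (d 0)) (d (l - 1)) j b"
      by (rule prodW_act[where S = S and d = d and k = "l - 1", OF _ assms(4) \<open>b < d 0\<close>])
    then show "tr (prodW d (act d S W) (l - 1)) b j
        = tr (mmul (S (l - 1)) (mmul ?B (tr (S 0)) (d 0)) (d (l - 1))) b j"
      unfolding tr_apply[of _ b j] .
  qed
  also have "\<dots> = mmul (S l) (mmul (mmul (tr ?A) (mmul ?R (tr ?B) (d 0)) (d L)) (tr (S (l - 1))) (d (l - 1))) (d l) i j"
    using orthS[of L] orthS[of 0] by (simp add: tr_mmul mmul_assoc mmul_orth_cancel)
  finally have 1: "hgrad d L lam y (act d S W) l i j
    = mmul (S l) (mmul (mmul (tr ?A) (mmul ?R (tr ?B) (d 0)) (d L)) (tr (S (l - 1))) (d (l - 1))) (d l) i j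
      + lam * act d S W l i j"
    unfolding hgrad_def by (rule arg_cong)
  have 2: "mmul (hgrad d L lam y W l) T n
     = (\<lambda>i j. mmul (mmul (tr ?A) (mmul ?R (tr ?B) (d 0)) (d L)) T n i j + lam * mmul (W l) T n i j)" for T n
    unfolding hgrad_def mmul_add_left mmul_scale_left ..
  have 3: "mmul A (\<lambda>i j. B i j + lam * C i j) n i j
     = mmul A B n i j + lam * mmul A C n i j" for A B C n
    unfolding mmul_add_right mmul_scale_right ..
  show ?thesis unfolding 1 2 3 act_def ..
qed

lemma gradG_norm_act: "gradG_norm d L lam y (act d S W) = gradG_norm d L lam y W"
proof -
  have "frob2 (d l) (d (l - 1)) (hgrad d L lam y (act d S W) l)
      = frob2 (d l) (d (l - 1)) (hgrad d L lam y W l)" if "l \<in> {1..L}" for l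
  proof -
    have "frob2 (d l) (d (l - 1)) (hgrad d L lam y (act d S W) l)
       = frob2 (d l) (d (l - 1)) (mmul (S l) (mmul (hgrad d L lam y W l) (tr (S (l - 1))) (d (l - 1))) (d l))"
      by (rule frob2_cong) (use that in \<open>auto simp: hgrad_act\<close>)
    moreover have "orthogonal_mat (d l) (S l)" "orthogonal_mat (d (l - 1)) (S (l - 1))"
      using that by (auto intro!: orthS)
    ultimately show ?thesis by (simp only: frob2_sandwich)
  qed
  then show ?thesis by (simp add: gradG_norm_eq)
qed

end

section \<open>The kernel of the Hessian\<close>

lemma sum_reindex_rev:
  fixes f :: "nat \<Rightarrow> real"
  shows "(\<Sum>m=1..n. f (n - m)) = (\<Sum>k<n. f k)"
  by (rule sum.reindex_bij_witness[of _ "\<lambda>k. n - k" "\<lambda>m. n - m"]) auto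

lemma sum_reindex_pred:
  fixes f :: "nat \<Rightarrow> real"
  shows "(\<Sum>m=1..n. f (m - 1)) = (\<Sum>k<n. f k)"
  by (rule sum.reindex_bij_witness[of _ Suc "\<lambda>m. m - 1"]) auto

text \<open>The difference of the equations has the factor \<open>\<beta> - \<alpha> > 0\<close>.
  Only the other factor \<open>\<alpha> + \<beta>\<close> of the determinant can vanish, and all
  degenerate cases are hidden in it.\<close>

lemma symmetric_pair_eq:
  fixes x w :: real
  assumes "\<alpha> * w + \<beta> * x = 0" "\<alpha> * x + \<beta> * w = 0" "\<alpha> \<le> 0" "\<beta> > 0"
  shows "x = w" "(\<alpha> + \<beta>) * x = 0"
proof -
  have "(\<beta> - \<alpha>) * (x - w) = 0" using assms(1,2) by algebra
  then show "x = w" using assms(3,4) by auto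
  then show "(\<alpha> + \<beta>) * x = 0" using assms(1) by (simp add: distrib_right)
qed

text \<open>A solution \<open>X\<close> of the Hessian equations \<open>hess\<close> at \<open>diag(b)\<close> that is orthogonal to the orbit
  (\<open>chain\<close> combines balancedness with orthogonality to the rotations of the hidden layers).\<close>
locale kernel =
  fixes d :: "nat \<Rightarrow> nat" and L N :: nat and lam :: real and b Y :: "nat \<Rightarrow> real"
    and X :: "nat \<Rightarrow> mat"
  assumes L2: "L \<ge> 2" and lam: "lam > 0" and dN: "\<And>l. l \<le> L \<Longrightarrow> N \<le> d l"
    and b0: "\<And>i. b i \<ge> 0" and bN: "\<And>i. i \<ge> N \<Longrightarrow> b i = 0"
    and Y0: "\<And>i. Y i \<ge> 0" and YN: "\<And>i. i \<ge> N \<Longrightarrow> Y i = 0"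
    and crit: "\<And>i. b i ^ (2 * L - 1) - Y i * b i ^ (L - 1) + lam * b i = 0"
    and nondeg0: "\<And>i. L = 2 \<Longrightarrow> Y i \<noteq> lam"
    and nondeg: "\<And>i. b i > 0 \<Longrightarrow> real L * b i ^ (2 * L - 2) \<noteq> lam * (real L - 2)"
    and outside: "\<And>l i j. i \<ge> d l \<or> j \<ge> d (l - 1) \<Longrightarrow> X l i j = 0"
    and hess: "\<And>l i j. 1 \<le> l \<Longrightarrow> l \<le> L \<Longrightarrow> i < d l \<Longrightarrow> j < d (l - 1) \<Longrightarrow>
      (b j ^ L - Y j) * b j ^ (l - 1) * (\<Sum>m=1..L-l. b j ^ (L - l - m) * X (m + l) j i * b i ^ (m - 1))
      + b i ^ (L - l) * b j ^ (l - 1) * (\<Sum>m=1..L. b i ^ (L - m) * X m i j * b j ^ (m - 1))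
      + (b i ^ L - Y i) * b i ^ (L - l) * (\<Sum>m=1..l-1. b j ^ (l - 1 - m) * X m j i * b i ^ (m - 1))
      + lam * X l i j = 0"
    and chain: "\<And>l i j. 1 \<le> l \<Longrightarrow> l < L \<Longrightarrow> i < d l \<Longrightarrow> j < d l \<Longrightarrow>
      b i * X (Suc l) i j = b j * X l i j"
    and outer: "\<And>i j. i < N \<Longrightarrow> j < N \<Longrightarrow> i \<noteq> j \<Longrightarrow> Y i = Y j \<Longrightarrow> Y i > 0 \<Longrightarrow>
      b i * X 1 i j - b j * X 1 j i + b i * X L j i - b j * X L i j = 0"
begin

text \<open>Only powers of \<open>b\<close> with exponent zero survive. For \<open>L >= 3\<close>
  every coupling term contains a positive power, which leaves \<open>lam * X l i j = 0\<close>. For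
  \<open>L = 2\<close> the exponents can all be zero, and the entries \<open>X 1 i j\<close> and
  \<open>X 2 j i\<close> are coupled through \<open>Y j\<close> with determinant
  \<open>lam^2 - (Y j)^2\<close>, nonzero by \<open>nondeg0\<close>.\<close>

lemma vanish_zero_zero:
  assumes bi: "b i = 0" and bj: "b j = 0" and l: "1 \<le> l" "l \<le> L" "i < d l" "j < d (l - 1)"
  shows "X l i j = 0"
proof (cases "L = 2")
  case True
  have e1: "lam * X 1 i j = Y j * X 2 j i" if "b i = 0" "b j = 0" "i < d 1" "j < d 0" for i j
    using hess[of 1 i j] that True by (simp add: numeral_2_eq_2)
  have e2: "lam * X 2 j i = Y j * X 1 i j" if "b i = 0" "b j = 0" "i < d 1" "j < d 2" for i j
    using hess[of 2 j i] that True by (simp add: numeral_2_eq_2)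
  have main: "X 1 i j = 0 \<and> X 2 j i = 0" if "b i = 0" "b j = 0" "i < d 1" for i j
  proof -
    \<comment> \<open>\<open>d 0\<close> and \<open>d 2\<close> may differ, so index
      \<open>j\<close> may be present in one of the two layers only. In the other one
      \<open>Y j\<close> and the entry are zero, and the equation persists.\<close>
    have f1: "lam * X 1 i j = Y j * X 2 j i"
    proof (cases "j < d 0")
      case False
      then have "Y j = 0" using YN dN[of 0] by simp
      then show ?thesis using outside False by simp
    qed (use e1 that in blast)
    have f2: "lam * X 2 j i = Y j * X 1 i j"
    proof (cases "j < d 2")
      case False
      then have "Y j = 0" using YN[of j] dN[of 2] True by simp
      then show ?thesis using outside False by simp
    qed (use e2 that in blast)
    have "lam + Y j > 0" "lam - Y j \<noteq> 0" using lam Y0[of j] nondeg0[OF True, of j] by auto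
    moreover have "(lam + Y j) * (lam - Y j) * X 1 i j = 0" "(lam + Y j) * (lam - Y j) * X 2 j i = 0"
      using f1 f2 by algebra+
    ultimately show ?thesis by (metis less_irrefl mult_eq_0_iff)
  qed
  have "l = 1 \<or> l = 2" using l True by auto
  then show ?thesis using main[of i j] main[of j i] bi bj l by auto
next
  case False
  then have L3: "L \<ge> 3" using L2 by simp
  have z: "(0::real) ^ n = (if n = 0 then 1 else 0)" for n by simp
  have s1: "b j ^ (l - 1) * (\<Sum>m=1..L-l. b j ^ (L - l - m) * X (m + l) j i * b i ^ (m - 1)) = 0"
  proof (cases "l = 1")
    case True
    have "b j ^ (L - l - m) * X (m + l) j i * b i ^ (m - 1) = 0" if "m \<in> {1..L-l}" for m
      using that L3 True by (auto simp: bi bj z)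
    then have "(\<Sum>m=1..L-l. b j ^ (L - l - m) * X (m + l) j i * b i ^ (m - 1)) = 0"
      by (intro sum.neutral ballI)
    then show ?thesis by (simp only: mult_zero_right)
  qed (use l in \<open>simp add: bj\<close>)
  have s2: "b i ^ (L - l) * b j ^ (l - 1) = 0"
    using l L3 by (auto simp: bi bj z)
  have s3: "b i ^ (L - l) * (\<Sum>m=1..l-1. b j ^ (l - 1 - m) * X m j i * b i ^ (m - 1)) = 0"
  proof (cases "l = L")
    case True
    have "b j ^ (l - 1 - m) * X m j i * b i ^ (m - 1) = 0" if "m \<in> {1..l-1}" for m
      using that L3 True by (auto simp: bi bj z)
    then have "(\<Sum>m=1..l-1. b j ^ (l - 1 - m) * X m j i * b i ^ (m - 1)) = 0"
      by (intro sum.neutral ballI)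
    then show ?thesis by (simp only: mult_zero_right)
  qed (use l in \<open>simp add: bi\<close>)
  have "lam * X l i j = 0"
    using hess[OF l] s2 by (simp only: mult.assoc s1[unfolded mult.assoc] s3[unfolded mult.assoc])
  then show ?thesis using lam by simp
qed

text \<open>Division by \<open>b i\<close> alone is required, so \<open>b j = 0\<close> is allowed.
  The family \<open>(i, j)\<close> is determined by its first entry \<open>x\<close>, the family
  \<open>(j, i)\<close> by its last entry \<open>w\<close>, and the Hessian equations at
  \<open>(1, i, j)\<close> and \<open>(L, j, i)\<close> already form a closed system for
  \<open>x\<close> and \<open>w\<close>.\<close>

lemma vanish_positive:
  assumes bi: "b i > 0"
  shows "1 \<le> l \<Longrightarrow> l \<le> L \<Longrightarrow> X l i j = 0" "1 \<le> l \<Longrightarrow> l \<le> L \<Longrightarrow> X l j i = 0"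
proof -
  define p q \<rho> where "p = b i" and "q = b j" and "\<rho> = q / p"
  have p: "p > 0" and q: "q \<ge> 0" and \<rho>0: "\<rho> \<ge> 0" and q\<rho>: "q = \<rho> * p"
    using bi b0[of j] by (auto simp: p_def q_def \<rho>_def)
  have iN: "i < N" using bN[of i] bi by (cases "i < N") auto
  have id: "i < d l" if "l \<le> L" for l using iN dN[OF that] by simp
  have j\<rho>: "\<rho> = 0" if "d l \<le> j" "l \<le> L" for l
    using bN[of j] dN[OF that(2)] that by (simp add: \<rho>_def q_def)
  define x w where "x = X 1 i j" and "w = X L j i"
  have X1: "X (Suc k) i j = \<rho> ^ k * x" if "Suc k \<le> L" for k
    using that
  proof (induction k)
    case (Suc k)
    show ?case
    proof (cases "j < d (Suc k)")
      case True
      then have "p * X (Suc (Suc k)) i j = q * X (Suc k) i j"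
        using chain[of "Suc k" i j] id Suc.prems by (simp add: p_def q_def)
      then have "X (Suc (Suc k)) i j = \<rho> * X (Suc k) i j"
        using p by (simp add: \<rho>_def field_simps)
      then show ?thesis using Suc by simp
    next
      case False
      then show ?thesis using j\<rho>[of "Suc k"] Suc.prems outside[of "Suc (Suc k)" i j] by simp
    qed
  qed (simp add: x_def)
  have X2: "X (L - k) j i = \<rho> ^ k * w" if "k < L" for k
    using that
  proof (induction k)
    case (Suc k)
    define l where "l = L - Suc k"
    have l: "L - k = Suc l" "1 \<le> l" "l < L" using Suc.prems by (auto simp: l_def)
    show ?case
    proof (cases "j < d l")
      case True
      then have "q * X (Suc l) j i = p * X l j i"
        using chain[of l j i] id[of l] l by (simp add: p_def q_def)
      then have "X l j i = \<rho> * X (Suc l) j i"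
        using p by (simp add: \<rho>_def field_simps)
      then show ?thesis using Suc l by (simp flip: l_def)
    next
      case False
      then show ?thesis using j\<rho>[of l] l outside[of l j i] by (simp flip: l_def)
    qed
  qed (simp add: w_def)
  \<comment> \<open>With the geometric form inserted, each summand of the Hessian sums carries one
    power of \<open>\<rho>\<close> from \<open>X\<close> and an equal one from
    \<open>q = \<rho> * p\<close>; hence the even exponents. \<open>r\<close> is the
    \<open>j\<close>-th diagonal entry of the residual.\<close>
  define S1 S2 where "S1 = (\<Sum>k<L-1. \<rho> ^ (2 * k))" and "S2 = (\<Sum>k<L. \<rho> ^ (2 * k))"
  define r where "r = q ^ L - Y j"
  define \<alpha> \<beta> where "\<alpha> = r * p ^ (L - 2) * S1" and "\<beta> = p ^ (2 * L - 2) * S2 + lam"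
  \<comment> \<open>For \<open>j >= N\<close> one of \<open>X 1 i j\<close> and
    \<open>X L j i\<close> may be out of range, with no Hessian equation of its own. The coupling
    \<open>\<alpha>\<close> then vanishes, so the missing equation holds trivially.\<close>
  have rN: "\<alpha> = 0" if "N \<le> j"
    using that L2 by (simp add: \<alpha>_def r_def q_def bN YN)
  have pp: "p ^ (L - 1) * p ^ (L - 1) = p ^ (2 * L - 2)"
  proof -
    have "2 * L - 2 = (L - 1) + (L - 1)" by simp
    then show ?thesis by (simp only: power_add)
  qed
  have eq1: "\<alpha> * w + \<beta> * x = 0"
  proof (cases "j < d 0")
    case True
    have A: "(\<Sum>m=1..L-1. q ^ (L - 1 - m) * X (m + 1) j i * p ^ (m - 1)) = p ^ (L - 2) * S1 * w"
    proof -
      have "(\<Sum>m=1..L-1. q ^ (L - 1 - m) * X (m + 1) j i * p ^ (m - 1))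
         = (\<Sum>m=1..L-1. p ^ (L - 2) * w * \<rho> ^ (2 * (L - 1 - m)))"
      proof (rule sum.cong)
        fix m assume m: "m \<in> {1..L-1}"
        then have "L - (L - 1 - m) = m + 1" by auto
        then have "X (m + 1) j i = \<rho> ^ (L - 1 - m) * w" using X2[of "L - 1 - m"] m by auto
        moreover have "L - 2 = (L - 1 - m) + (m - 1)" using m by auto
        ultimately show "q ^ (L - 1 - m) * X (m + 1) j i * p ^ (m - 1)
           = p ^ (L - 2) * w * \<rho> ^ (2 * (L - 1 - m))"
          by (simp only: q\<rho> power_mult_distrib power_add mult_2) (simp only: mult_ac)
      qed simp
      then show ?thesis
        by (simp only: sum_distrib_left[symmetric] S1_def
            sum_reindex_rev[of "\<lambda>k. \<rho> ^ (2 * k)"]) (simp only: mult_ac)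
    qed
    have B: "(\<Sum>m=1..L. p ^ (L - m) * X m i j * q ^ (m - 1)) = p ^ (L - 1) * S2 * x"
    proof -
      have "(\<Sum>m=1..L. p ^ (L - m) * X m i j * q ^ (m - 1))
         = (\<Sum>m=1..L. p ^ (L - 1) * x * \<rho> ^ (2 * (m - 1)))"
      proof (rule sum.cong)
        fix m assume m: "m \<in> {1..L}"
        then have "X m i j = \<rho> ^ (m - 1) * x" using X1[of "m - 1"] by auto
        moreover have "L - 1 = (L - m) + (m - 1)" using m by auto
        ultimately show "p ^ (L - m) * X m i j * q ^ (m - 1)
           = p ^ (L - 1) * x * \<rho> ^ (2 * (m - 1))"
          by (simp only: q\<rho> power_mult_distrib power_add mult_2) (simp only: mult_ac)
      qed simp
      then show ?thesis
        by (simp only: sum_distrib_left[symmetric] S2_def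
            sum_reindex_pred[of "\<lambda>k. \<rho> ^ (2 * k)"]) (simp only: mult_ac)
    qed
    have "r * (p ^ (L - 2) * S1 * w) + p ^ (L - 1) * (p ^ (L - 1) * S2 * x) + lam * x = 0"
      using hess[of 1 i j] id[of 1] True L2 A B
      by (simp add: r_def x_def flip: p_def q_def)
    then show ?thesis unfolding \<alpha>_def \<beta>_def pp[symmetric] by (simp only: algebra_simps)
  next
    case False
    then have "x = 0" "N \<le> j" using outside[of 1 i j] dN[of 0] by (auto simp: x_def)
    then show ?thesis by (simp add: rN)
  qed
  have eq2: "\<alpha> * x + \<beta> * w = 0"
  proof (cases "j < d L")
    case True
    have A: "(\<Sum>m=1..L-1. p ^ (L - 1 - m) * X m i j * q ^ (m - 1)) = p ^ (L - 2) * S1 * x"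
    proof -
      have "(\<Sum>m=1..L-1. p ^ (L - 1 - m) * X m i j * q ^ (m - 1))
         = (\<Sum>m=1..L-1. p ^ (L - 2) * x * \<rho> ^ (2 * (m - 1)))"
      proof (rule sum.cong)
        fix m assume m: "m \<in> {1..L-1}"
        then have "X m i j = \<rho> ^ (m - 1) * x" using X1[of "m - 1"] by auto
        moreover have "L - 2 = (L - 1 - m) + (m - 1)" using m by auto
        ultimately show "p ^ (L - 1 - m) * X m i j * q ^ (m - 1)
           = p ^ (L - 2) * x * \<rho> ^ (2 * (m - 1))"
          by (simp only: q\<rho> power_mult_distrib power_add mult_2) (simp only: mult_ac)
      qed simp
      then show ?thesis
        by (simp only: sum_distrib_left[symmetric] S1_def
            sum_reindex_pred[of "\<lambda>k. \<rho> ^ (2 * k)"]) (simp only: mult_ac)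
    qed
    have B: "(\<Sum>m=1..L. q ^ (L - m) * X m j i * p ^ (m - 1)) = p ^ (L - 1) * S2 * w"
    proof -
      have "(\<Sum>m=1..L. q ^ (L - m) * X m j i * p ^ (m - 1))
         = (\<Sum>m=1..L. p ^ (L - 1) * w * \<rho> ^ (2 * (L - m)))"
      proof (rule sum.cong)
        fix m assume m: "m \<in> {1..L}"
        then have "X m j i = \<rho> ^ (L - m) * w" using X2[of "L - m"] by simp
        moreover have "L - 1 = (L - m) + (m - 1)" using m by auto
        ultimately show "q ^ (L - m) * X m j i * p ^ (m - 1)
           = p ^ (L - 1) * w * \<rho> ^ (2 * (L - m))"
          by (simp only: q\<rho> power_mult_distrib power_add mult_2) (simp only: mult_ac)
      qed simp
      then show ?thesis
        by (simp only: sum_distrib_left[symmetric] S2_def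
            sum_reindex_rev[of "\<lambda>k. \<rho> ^ (2 * k)"]) (simp only: mult_ac)
    qed
    have "r * (p ^ (L - 2) * S1 * x) + p ^ (L - 1) * (p ^ (L - 1) * S2 * w) + lam * w = 0"
      using hess[of L j i] id[of "L - 1"] True L2 A B
      by (simp add: r_def w_def flip: p_def q_def)
    then show ?thesis unfolding \<alpha>_def \<beta>_def pp[symmetric] by (simp only: algebra_simps)
  next
    case False
    then have "w = 0" "N \<le> j" using outside[of L j i] dN[of L] by (auto simp: w_def)
    then show ?thesis by (simp add: rN)
  qed
  have S1: "S1 \<ge> 0" and S2: "S2 \<ge> 0"
    using \<rho>0 by (auto simp: S1_def S2_def intro!: sum_nonneg)
  obtain M where M: "L = Suc (Suc M)" using L2 by (auto dest: le_Suc_ex)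
  have Yi: "Y i * p ^ M = p ^ (2 * M + 2) + lam"
  proof -
    have "p * (p ^ (2 * M + 2) + lam - Y i * p ^ M) = 0"
      using crit[of i] by (simp add: M p_def algebra_simps power_add power2_eq_square)
    then show ?thesis using p by simp
  qed
  have Yj: "Y j * q ^ M = q ^ (2 * M + 2) + lam" if "q > 0"
  proof -
    have "q * (q ^ (2 * M + 2) + lam - Y j * q ^ M) = 0"
      using crit[of j] by (simp add: M q_def algebra_simps power_add power2_eq_square)
    then show ?thesis using that by simp
  qed
  \<comment> \<open>Criticality of \<open>b j\<close> in terms of the residual:
    \<open>q^(L-2) * r = - lam\<close>. This fixes the sign of \<open>r\<close>, hence
    \<open>\<alpha> \<le> 0\<close>, as \<open>symmetric_pair_eq\<close> demands.\<close>
  have rq: "q ^ M * r = - lam" if "q > 0"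
  proof -
    have "q ^ M * q ^ L = q ^ (2 * M + 2)"
      unfolding power_add[symmetric] by (simp add: M mult_2)
    then show ?thesis using Yj[OF that] by (simp add: r_def right_diff_distrib mult.commute)
  qed
  have "r \<le> 0"
  proof (cases "q > 0")
    case True
    then have "q ^ M * r < 0" "q ^ M > 0" using rq lam by auto
    then show ?thesis by (meson less_eq_real_def less_imp_not_less mult_less_0_iff)
  next
    case False
    then show ?thesis using q Y0[of j] by (simp add: r_def M)
  qed
  then have "\<alpha> \<le> 0" unfolding \<alpha>_def using p S1
    by (simp add: mult_nonpos_nonneg)
  moreover have "\<beta> > 0" unfolding \<beta>_def using p S2 lam
    by (simp add: add_nonneg_pos)
  ultimately have xw: "x = w" and ab: "(\<alpha> + \<beta>) * x = 0"
    using symmetric_pair_eq[OF eq1 eq2] by auto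
  have "x = 0"
  proof (rule ccontr)
    assume "x \<noteq> 0"
    then have ab0: "\<alpha> + \<beta> = 0" using ab by simp
    show False
    proof (cases "\<rho> = 1")
      case True
      then have "q = p" by (simp add: q\<rho>)
      then have "p ^ M * r = - lam" using rq p by simp
      moreover have "\<alpha> = p ^ M * r * (real M + 1)" "\<beta> = p ^ (2 * L - 2) * real L + lam"
        by (auto simp: \<alpha>_def \<beta>_def S1_def S2_def True M)
      \<comment> \<open>Equal values \<open>b i = b j\<close>, which includes \<open>i = j\<close>:
        here \<open>\<alpha> + \<beta> = L p^(2L-2) - lam (L-2)\<close>, the derivative at
        \<open>p\<close> of the polynomial \<open>a^(2L-1) - Y i * a^(L-1) + lam * a\<close>. It
        vanishes only at a double root.\<close>
      ultimately have "real L * p ^ (2 * L - 2) = lam * real M"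
        using ab0 by (simp add: algebra_simps)
      then show False using nondeg[OF bi] by (simp add: M p_def)
    next
      case False
      define u P T where "u = \<rho> ^ M" and "P = p ^ (2 * M + 2)" and "T = p ^ M"
      have g1: "S1 * (1 - \<rho>\<^sup>2) = 1 - u\<^sup>2 * \<rho>\<^sup>2"
        using one_diff_power_eq[of "\<rho>\<^sup>2" "L - 1"]
        by (simp add: S1_def M u_def power_mult mult.commute power_add power2_eq_square power_mult_distrib)
      have g2: "S2 * (1 - \<rho>\<^sup>2) = 1 - u\<^sup>2 * \<rho>\<^sup>2 * \<rho>\<^sup>2"
        using one_diff_power_eq[of "\<rho>\<^sup>2" "L"]
        by (simp add: S2_def M u_def power_mult mult.commute power_add power2_eq_square power_mult_distrib mult.assoc)
      have aM: "\<alpha> = r * T * S1" and bM: "\<beta> = P * S2 + lam"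
        by (auto simp: \<alpha>_def \<beta>_def M P_def T_def)
      have Yij: "Y i = Y j"
      proof (cases "q > 0")
        case True
        then have \<rho>pos: "\<rho> > 0" using p by (simp add: \<rho>_def)
        have qM: "q ^ M = u * T" by (simp add: q\<rho> u_def T_def power_mult_distrib)
        have q2: "q ^ (2 * M + 2) = u\<^sup>2 * \<rho>\<^sup>2 * P"
          by (simp add: q\<rho> u_def P_def power_mult_distrib power_add power_mult power2_eq_square)
        have h1: "u * T * r = - lam" using rq[OF True] by (simp add: qM)
        have h2: "u * T * Y j = u\<^sup>2 * \<rho>\<^sup>2 * P + lam" using Yj[OF True] unfolding qM q2 by (simp only: mult_ac)
        have h3: "T * Y i = P + lam" using Yi by (simp add: P_def T_def mult.commute)
        \<comment> \<open>The factor \<open>1 - \<rho>\<^sup>2\<close> sums the geometric series,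
          and \<open>u\<close> turns \<open>r\<close> into \<open>- lam\<close> by
          \<open>h1\<close>. What remains factors through \<open>Y i - Y j\<close>, so a vanishing
          determinant forces \<open>Y i = Y j\<close>.\<close>
        have "u * (\<alpha> + \<beta>) * (1 - \<rho>\<^sup>2) = (1 + u * \<rho>\<^sup>2) * (u * T * (Y i - Y j))"
          unfolding aM bM using h1 h2 h3 g1 g2 by algebra
        then have "(1 + u * \<rho>\<^sup>2) * (u * T * (Y i - Y j)) = 0" using ab0 by simp
        moreover have "u > 0" using \<rho>pos by (simp add: u_def)
        moreover have "1 + u * \<rho>\<^sup>2 > 0" using \<open>u > 0\<close> by (simp add: add_pos_nonneg)
        ultimately show ?thesis using p by (auto simp: T_def)
      next
        case False
        then have "q = 0" using q by simp
        then have "\<rho> = 0" by (simp add: \<rho>_def)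
        then have "S1 = 1" "S2 = 1" using g1 g2 by auto
        then have "p ^ M * (Y i - Y j) = 0"
          using ab0 Yi by (simp add: aM bM r_def P_def T_def \<open>q = 0\<close> M algebra_simps)
        then show ?thesis using p by simp
      qed
      have Ypos: "Y i > 0"
      proof -
        have "Y i * p ^ M > 0" using Yi p lam by (simp only:) (intro add_pos_pos zero_less_power)
        then show ?thesis using p by (simp add: zero_less_mult_iff)
      qed
      have jN: "j < N" using YN[of j] Ypos Yij by (cases "j < N") auto
      have "i \<noteq> j" using False p by (auto simp: \<rho>_def p_def q_def)
      \<comment> \<open>Now \<open>Y i = Y j > 0\<close> while \<open>b i\<close> and
        \<open>b j\<close> differ. The surviving kernel direction is tangent to a rotation of both
        outer spaces, and the condition \<open>outer\<close> removes it: it becomes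
        \<open>2 p x (1 - \<rho>^L) = 0\<close>.\<close>
      then have "p * x - q * X 1 j i + p * w - q * X L i j = 0"
        using outer[OF iN jN _ Yij Ypos] by (simp add: p_def q_def x_def w_def)
      moreover have "X 1 j i = \<rho> ^ (L - 1) * w" "X L i j = \<rho> ^ (L - 1) * x"
        using X2[of "L - 1"] X1[of "L - 1"] by (auto simp: M)
      ultimately have "2 * p * x * (1 - \<rho> ^ L) = 0"
        unfolding q\<rho> by (simp add: xw M algebra_simps)
      moreover have "\<rho> ^ L \<noteq> 1"
        using False \<rho>0 power_eq_imp_eq_base[of \<rho> L 1] by (auto simp: M)
      ultimately show False using p \<open>x \<noteq> 0\<close> by auto
    qed
  qed
  then have "w = 0" using xw by simp
  show "1 \<le> l \<Longrightarrow> l \<le> L \<Longrightarrow> X l i j = 0"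
    using X1[of "l - 1"] \<open>x = 0\<close> by simp
  show "1 \<le> l \<Longrightarrow> l \<le> L \<Longrightarrow> X l j i = 0"
    using X2[of "L - l"] \<open>w = 0\<close> by simp
qed

lemma kernel_trivial:
  assumes "1 \<le> l" "l \<le> L"
  shows "X l i j = 0"
proof (cases "b i > 0 \<or> b j > 0")
  case True
  then show ?thesis using vanish_positive assms by blast
next
  case False
  then have "b i = 0" "b j = 0" using b0[of i] b0[of j] by auto
  then show ?thesis
    using vanish_zero_zero[of i j l] outside[of l i j] assms
    by (cases "i < d l \<and> j < d (l - 1)") auto
qed

end

section \<open>Linearization along sequences\<close>

definition diagm :: "(nat \<Rightarrow> real) \<Rightarrow> mat" where
  "diagm u = (\<lambda>i j. if i = j then u i else 0)"

lemma tr_diagm [simp]: "tr (diagm u) = diagm u"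
  by (auto simp: tr_def diagm_def fun_eq_iff)

lemma diagm_commute: "diagm u i j = diagm u j i"
  by (simp add: diagm_def)

lemma mmul_diagm_left: "mmul (diagm u) C n i j = (if i < n then u i * C i j else 0)"
  by (simp add: mmul_def diagm_def if_distrib[of "\<lambda>x. x * _"] cong: if_cong)

lemma mmul_diagm_right: "mmul C (diagm u) n i j = (if j < n then C i j * u j else 0)"
  by (simp add: mmul_def diagm_def if_distrib[of "\<lambda>x. _ * x"] cong: if_cong)

text \<open>Tychonoff's theorem: function types carry the product topology. Three applications cover
  tuples of matrices.\<close>

lemma compact_functions:
  fixes S :: "'b::topological_space set"
  assumes "compact S"
  shows "compact {f :: 'a \<Rightarrow> 'b. \<forall>x. f x \<in> S}"
proof -
  have "compactin (product_topology (\<lambda>_. euclidean) UNIV) (PiE UNIV (\<lambda>_::'a. S))"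
    using assms by (simp add: compactin_PiE)
  moreover have "PiE UNIV (\<lambda>_::'a. S) = {f. \<forall>x. f x \<in> S}"
    by (auto simp: PiE_def)
  ultimately show ?thesis
    by (simp add: euclidean_product_topology)
qed

lemma compact_unit_tensors: "compact {f :: nat \<Rightarrow> mat. \<forall>l i j. f l i j \<in> {-1..1}}"
  using compact_functions[OF compact_functions[OF compact_functions[OF compact_Icc]]]
  by simp

lemma tendsto_entries:
  assumes "(f \<longlongrightarrow> (g :: nat \<Rightarrow> mat)) F"
  shows "((\<lambda>x. f x l i j) \<longlongrightarrow> g l i j) F"
proof -
  have *: "((\<lambda>x. h x i) \<longlongrightarrow> k i) F" if "(h \<longlongrightarrow> k) F"
    for h :: "'a \<Rightarrow> 'c \<Rightarrow> 'd::topological_space" and k i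
    using continuous_on_tendsto_compose[OF continuous_on_product_coordinates that, of i] by simp
  show ?thesis by (rule *[OF *[OF *[OF assms]]])
qed

text \<open>The expansion \<open>f n = c + t n * f' + o(t n)\<close>. Expansions along one sequence
  obey the product rule, and nothing more is required to linearize the gradient, which is polynomial
  in the entries.\<close>

definition expands :: "(nat \<Rightarrow> real) \<Rightarrow> (nat \<Rightarrow> real) \<Rightarrow> real \<Rightarrow> real \<Rightarrow> bool" where
  "expands t f c f' \<longleftrightarrow> (\<lambda>n. (f n - c) / t n) \<longlonglongrightarrow> f'"

locale infinitesimal =
  fixes t :: "nat \<Rightarrow> real"
  assumes tpos: "\<And>n. t n > 0" and tlim: "t \<longlonglongrightarrow> 0"
begin

lemma expands_tendsto:
  assumes "expands t f c f'" shows "f \<longlonglongrightarrow> c"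
proof -
  have "(\<lambda>n. c + t n * ((f n - c) / t n)) \<longlonglongrightarrow> c + 0 * f'"
    using assms tlim unfolding expands_def by (intro tendsto_intros)
  moreover have "c + t n * ((f n - c) / t n) = f n" for n
    using tpos[of n] by simp
  ultimately show ?thesis by simp
qed

lemma expands_const: "expands t (\<lambda>_. c) c 0"
  by (simp add: expands_def)

lemma expands_add:
  assumes "expands t f c f'" "expands t g e g'"
  shows "expands t (\<lambda>n. f n + g n) (c + e) (f' + g')"
proof -
  have "(f n + g n - (c + e)) / t n = (f n - c) / t n + (g n - e) / t n" for n
    by (simp add: diff_divide_distrib add_divide_distrib)
  then show ?thesis using assms by (simp add: expands_def tendsto_add)
qed

lemma expands_mult:
  assumes "expands t f c f'" "expands t g e g'"
  shows "expands t (\<lambda>n. f n * g n) (c * e) (f' * e + c * g')"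
proof -
  have "(f n * g n - c * e) / t n = (f n - c) / t n * g n + c * ((g n - e) / t n)" for n
    using tpos[of n] by (simp add: field_simps)
  moreover have "(\<lambda>n. (f n - c) / t n * g n + c * ((g n - e) / t n)) \<longlonglongrightarrow> f' * e + c * g'"
    using assms expands_tendsto[OF assms(2)] unfolding expands_def by (intro tendsto_intros)
  ultimately show ?thesis by (simp only: expands_def)
qed

lemma expands_cmult: "expands t f c f' \<Longrightarrow> expands t (\<lambda>n. k * f n) (k * c) (k * f')"
  using expands_mult[OF expands_const, of f c f' k] by simp

lemma expands_diff:
  assumes "expands t f c f'" "expands t g e g'"
  shows "expands t (\<lambda>n. f n - g n) (c - e) (f' - g')"
  using expands_add[OF assms(1) expands_cmult[OF assms(2), of "-1"]] by simp

lemma expands_sum: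
  assumes "\<And>k. k < m \<Longrightarrow> expands t (f k) (c k) (f' k)"
  shows "expands t (\<lambda>n. \<Sum>k<m. f k n) (\<Sum>k<m. c k) (\<Sum>k<(m::nat). f' k)"
  using assms by (induction m) (auto intro: expands_add expands_const)

lemma expands_mmul:
  assumes "\<And>k. k < m \<Longrightarrow> expands t (\<lambda>n. A n i k) (A0 i k) (A' i k)"
    and "\<And>k. k < m \<Longrightarrow> expands t (\<lambda>n. B n k j) (B0 k j) (B' k j)"
  shows "expands t (\<lambda>n. mmul (A n) (B n) m i j) (mmul A0 B0 m i j)
    (mmul A' B0 m i j + mmul A0 B' m i j)"
  unfolding mmul_def sum.distrib[symmetric]
  by (intro expands_sum expands_mult assms)

text \<open>If \<open>f\<close> is \<open>o(t)\<close>, its limit \<open>c\<close> is zero too, so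
  the quotient that defines the linear term is the one that tends to zero.\<close>

lemma expands_negligible:
  assumes "expands t f c f'" "(\<lambda>n. f n / t n) \<longlonglongrightarrow> 0"
  shows "f' = 0"
proof -
  have "(\<lambda>n. f n / t n * t n) \<longlonglongrightarrow> 0 * 0" using assms(2) tlim by (intro tendsto_intros)
  moreover have "f n / t n * t n = f n" for n using tpos[of n] by simp
  ultimately have "f \<longlonglongrightarrow> 0" by simp
  then have "c = 0" using expands_tendsto[OF assms(1)] LIMSEQ_unique by blast
  then show ?thesis using assms LIMSEQ_unique unfolding expands_def by auto
qed

text \<open>The Leibniz rule: the \<open>m\<close>-th summand varies the \<open>m\<close>-th factor
  and replaces all others by \<open>diag(b)\<close>.\<close>

lemma expands_prodW:
  fixes W :: "nat \<Rightarrow> nat \<Rightarrow> mat"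
  assumes b: "\<And>l i. l \<le> k \<Longrightarrow> d l \<le> i \<Longrightarrow> b i = 0"
    and W: "\<And>l i j. 1 \<le> l \<Longrightarrow> l \<le> k \<Longrightarrow> i < d l \<Longrightarrow> j < d (l - 1) \<Longrightarrow>
      expands t (\<lambda>n. W n l i j) (diagm b i j) (X l i j)"
    and "i < d k" "j < d 0"
  shows "expands t (\<lambda>n. prodW d (W n) k i j) (diagm (\<lambda>i. b i ^ k) i j)
    (\<Sum>m=1..k. b i ^ (k - m) * X m i j * b j ^ (m - 1))"
  using assms
proof (induction k arbitrary: i)
  case 0
  then show ?case by (simp add: expands_const diagm_def)
next
  case (Suc k)
  define P' where "P' = (\<lambda>i j. \<Sum>m=1..k. b i ^ (k - m) * X m i j * b j ^ (m - 1))"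
  let ?P = "diagm (\<lambda>i. b i ^ k)"
  have "expands t (\<lambda>n. mmul (W n (Suc k)) (prodW d (W n) k) (d k) i j)
    (mmul (diagm b) ?P (d k) i j) (mmul (X (Suc k)) ?P (d k) i j + mmul (diagm b) P' (d k) i j)"
  proof (rule expands_mmul)
    fix a assume "a < d k"
    then show "expands t (\<lambda>n. W n (Suc k) i a) (diagm b i a) (X (Suc k) i a)"
      using Suc.prems by auto
    have "b i = 0" if "l \<le> k" "d l \<le> i" for l i
      using Suc.prems(1)[of l i] that by simp
    moreover have "expands t (\<lambda>n. W n l i j) (diagm b i j) (X l i j)"
      if "1 \<le> l" "l \<le> k" "i < d l" "j < d (l - 1)" for l i j
      using Suc.prems(2)[of l i j] that by simp
    ultimately show "expands t (\<lambda>n. prodW d (W n) k a j) (?P a j) (P' a j)"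
      unfolding P'_def using \<open>a < d k\<close> Suc.prems(4) by (rule Suc.IH)
  qed
  moreover have "mmul (diagm b) ?P (d k) i j = diagm (\<lambda>i. b i ^ Suc k) i j"
    using Suc.prems(1)[of k i] by (auto simp: mmul_diagm_left) (auto simp: diagm_def)
  \<comment> \<open>The product cuts off at column \<open>d k\<close>. Beyond it
    \<open>b j ^ k = 0\<close> because \<open>b j = 0\<close> and \<open>k > 0\<close>; for
    \<open>k = 0\<close> the cut-off is met by \<open>j < d 0\<close>.\<close>
  moreover have "mmul (X (Suc k)) ?P (d k) i j = X (Suc k) i j * b j ^ k"
    using Suc.prems(1)[of k j] Suc.prems(4) by (cases k) (auto simp: mmul_diagm_right)
  moreover have "mmul (diagm b) P' (d k) i j = b i * P' i j"
    using Suc.prems(1)[of k i] by (auto simp: mmul_diagm_left)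
  moreover have "X (Suc k) i j * b j ^ k + b i * P' i j
     = (\<Sum>m=1..Suc k. b i ^ (Suc k - m) * X m i j * b j ^ (m - 1))"
    by (simp add: P'_def sum_distrib_left Suc_diff_le mult.assoc)
  ultimately show ?case by simp
qed

end

text \<open>A sequence approaching \<open>diag(b)\<close> in the direction \<open>X\<close> whose
  gradient is small even compared with \<open>t\<close>. Such an \<open>X\<close> must lie in the
  kernel of the Hessian.\<close>

locale tangent_sequence = infinitesimal t
  for t :: "nat \<Rightarrow> real" +
  fixes d :: "nat \<Rightarrow> nat" and L :: nat and lam :: real and y b :: "nat \<Rightarrow> real"
    and W :: "nat \<Rightarrow> nat \<Rightarrow> mat" and X :: "nat \<Rightarrow> mat"
  assumes bd: "\<And>l i. l \<le> L \<Longrightarrow> d l \<le> i \<Longrightarrow> b i = 0"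
    and expW: "\<And>l i j. 1 \<le> l \<Longrightarrow> l \<le> L \<Longrightarrow> i < d l \<Longrightarrow> j < d (l - 1) \<Longrightarrow>
      expands t (\<lambda>n. W n l i j) (diagm b i j) (X l i j)"
    and critical: "\<And>l i j. 1 \<le> l \<Longrightarrow> l \<le> L \<Longrightarrow> i < d l \<Longrightarrow> j < d (l - 1) \<Longrightarrow>
      (\<lambda>n. hgrad d L lam y (W n) l i j / t n) \<longlonglongrightarrow> 0"
    and lam: "lam > 0" and L1: "L \<ge> 1"
begin

definition Y :: "nat \<Rightarrow> real" where
  "Y i = (if i < dmin d L then sqrt lam * y i else 0)"

text \<open>The three sums come from varying the left factor, the residual and the right factor of
  \<open>A^T E B^T\<close>. At \<open>diag(b)\<close> the unvaried factors are diagonal, and the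
  transposes pair entry \<open>(i, j)\<close> with \<open>(j, i)\<close> only.\<close>

lemma linearized_gradient:
  assumes l: "1 \<le> l" "l \<le> L" "i < d l" "j < d (l - 1)"
  shows "(b j ^ L - Y j) * b j ^ (l - 1) * (\<Sum>m=1..L-l. b j ^ (L - l - m) * X (m + l) j i * b i ^ (m - 1))
      + b i ^ (L - l) * b j ^ (l - 1) * (\<Sum>m=1..L. b i ^ (L - m) * X m i j * b j ^ (m - 1))
      + (b i ^ L - Y i) * b i ^ (L - l) * (\<Sum>m=1..l-1. b j ^ (l - 1 - m) * X m j i * b i ^ (m - 1))
      + lam * X l i j = 0"
proof -
  define A' where "A' = (\<lambda>i j. \<Sum>m=1..L-l. b i ^ (L - l - m) * X (m + l) i j * b j ^ (m - 1))"
  define B' where "B' = (\<lambda>i j. \<Sum>m=1..l-1. b i ^ (l - 1 - m) * X m i j * b j ^ (m - 1))"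
  define P' where "P' = (\<lambda>i j. \<Sum>m=1..L. b i ^ (L - m) * X m i j * b j ^ (m - 1))"
  define r where "r = (\<lambda>i. b i ^ L - Y i)"
  let ?A0 = "diagm (\<lambda>i. b i ^ (L - l))" and ?B0 = "diagm (\<lambda>i. b i ^ (l - 1))"
  \<comment> \<open>The diagonal of the residual vanishes out of range, and so do the powers of
    \<open>b\<close> in \<open>b_i\<close> and \<open>b_j\<close> below. This removes the cut-offs
    that products of rectangular matrices introduce.\<close>
  have r0: "r i = 0" if "d 0 \<le> i \<or> d L \<le> i" for i
    using that bd[of 0 i] bd[of L i] L1 by (auto simp: r_def Y_def dmin_def)
  have A: "expands t (\<lambda>n. prodL d (W n) L l a i) (?A0 a i) (A' a i)" if "a < d L" for a
  proof -
    have "b i = 0" if "k \<le> L - l" "d (k + l) \<le> i" for k i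
      using bd[of "k + l" i] that l by simp
    moreover have "expands t (\<lambda>n. W n (k + l) i j) (diagm b i j) (X (k + l) i j)"
      if "1 \<le> k" "k \<le> L - l" "i < d (k + l)" "j < d (k - 1 + l)" for k i j
    proof -
      have "k + l - 1 = k - 1 + l" using that by simp
      then show ?thesis using expW[of "k + l" i j] that l by simp
    qed
    ultimately show ?thesis
      unfolding A'_def
      by (rule expands_prodW[where d = "\<lambda>k. d (k + l)" and X = "\<lambda>k. X (k + l)"])
        (use l that in auto)
  qed
  have B: "expands t (\<lambda>n. prodW d (W n) (l - 1) j a) (?B0 j a) (B' j a)" if "a < d 0" for a
  proof -
    have "b i = 0" if "k \<le> l - 1" "d k \<le> i" for k i
      using bd[of k i] that l by simp
    moreover have "expands t (\<lambda>n. W n k i j) (diagm b i j) (X k i j)"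
      if "1 \<le> k" "k \<le> l - 1" "i < d k" "j < d (k - 1)" for k i j
      using expW[of k i j] that l by simp
    ultimately show ?thesis
      unfolding B'_def by (rule expands_prodW) (use l that in auto)
  qed
  have R: "expands t (\<lambda>n. resid d L lam y (W n) a c) (diagm r a c) (P' a c)"
    if "a < d L" "c < d 0" for a c
  proof -
    have "expands t (\<lambda>n. prodW d (W n) L a c) (diagm (\<lambda>i. b i ^ L) a c) (P' a c)"
      unfolding P'_def using bd expW that by (rule expands_prodW)
    from expands_diff[OF this expands_const, of "sqrt lam * Ymat d L y a c"]
    have "expands t (\<lambda>n. resid d L lam y (W n) a c)
      (diagm (\<lambda>i. b i ^ L) a c - sqrt lam * Ymat d L y a c) (P' a c)"
      by (simp add: resid_def)
    then show ?thesis by (simp add: diagm_def r_def Y_def Ymat_def split: if_splits)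
  qed
  define M0 where "M0 = mmul (diagm r) ?B0 (d 0)"
  define M' where "M' = (\<lambda>i j. mmul P' ?B0 (d 0) i j + mmul (diagm r) (tr B') (d 0) i j)"
  have M: "expands t (\<lambda>n. mmul (resid d L lam y (W n)) (tr (prodW d (W n) (l - 1))) (d 0) a j)
     (M0 a j) (M' a j)" if "a < d L" for a
    unfolding M0_def M'_def
  proof (rule expands_mmul)
    fix k assume "k < d 0"
    then show "expands t (\<lambda>n. resid d L lam y (W n) a k) (diagm r a k) (P' a k)"
      using R that by blast
    show "expands t (\<lambda>n. tr (prodW d (W n) (l - 1)) k j) (?B0 k j) (tr B' k j)"
      using B[OF \<open>k < d 0\<close>] by (simp add: tr_def diagm_commute[of _ k j])
  qed
  have G: "expands t (\<lambda>n. hgrad d L lam y (W n) l i j) (mmul ?A0 M0 (d L) i j + lam * diagm b i j)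
     (mmul (tr A') M0 (d L) i j + mmul ?A0 M' (d L) i j + lam * X l i j)"
    unfolding hgrad_def
  proof (intro expands_add expands_cmult expands_mmul expW l)
    fix k assume "k < d L"
    then show "expands t (\<lambda>n. mmul (resid d L lam y (W n)) (tr (prodW d (W n) (l - 1))) (d 0) k j)
       (M0 k j) (M' k j)" by (rule M)
    show "expands t (\<lambda>n. tr (prodL d (W n) L l) i k) (?A0 i k) (tr A' i k)"
      using A[OF \<open>k < d L\<close>] by (simp add: tr_def diagm_commute[of _ i k])
  qed
  have b_i: "b i ^ (L - l) = 0" if "d L \<le> i"
    using that l bd[of L i] by (cases "l = L") auto
  have b_j: "b j ^ (l - 1) = 0" if "d 0 \<le> j"
    using that l bd[of 0 j] by (cases "l = 1") auto
  have M0: "M0 = diagm (\<lambda>i. r i * b i ^ (l - 1))"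
    using r0 by (auto simp: M0_def mmul_diagm_left fun_eq_iff) (auto simp: diagm_def)
  have "mmul (tr A') M0 (d L) i j = r j * b j ^ (l - 1) * A' j i"
    using r0[of j] by (auto simp: M0 mmul_diagm_right tr_def)
  moreover have "M' i j = P' i j * b j ^ (l - 1) + r i * B' j i"
    using b_j r0[of i] by (auto simp: M'_def mmul_diagm_left mmul_diagm_right tr_def)
  then have "mmul ?A0 M' (d L) i j = b i ^ (L - l) * (P' i j * b j ^ (l - 1) + r i * B' j i)"
    using b_i by (auto simp: mmul_diagm_left)
  moreover have "mmul (tr A') M0 (d L) i j + mmul ?A0 M' (d L) i j + lam * X l i j = 0"
    using expands_negligible[OF G critical[OF l]] .
  ultimately have "r j * b j ^ (l - 1) * A' j i
     + b i ^ (L - l) * (P' i j * b j ^ (l - 1) + r i * B' j i) + lam * X l i j = 0" by simp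
  then show ?thesis
    unfolding A'_def[symmetric] B'_def[symmetric] P'_def[symmetric] r_def
    by (simp add: A'_def B'_def P'_def algebra_simps)
qed

text \<open>The gradient annihilates the direction of the gauge action \<open>W\<^sub>l \<mapsto> g W\<^sub>l\<close>,
  \<open>W\<^sub>l\<^sub>+\<^sub>1 \<mapsto> W\<^sub>l\<^sub>+\<^sub>1 g\<^sup>-\<^sup>1\<close> up to the regularizer.\<close>
lemma balance_identity:
  assumes "1 \<le> l" "l < L" "i < d l" "j < d l"
  shows "lam * (mmul (tr (V (Suc l))) (V (Suc l)) (d (Suc l)) i j - mmul (V l) (tr (V l)) (d (l - 1)) i j)
    = mmul (tr (V (Suc l))) (hgrad d L lam y V (Suc l)) (d (Suc l)) i j
      - mmul (hgrad d L lam y V l) (tr (V l)) (d (l - 1)) i j"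
proof -
  define M where "M l = mmul (tr (prodL d V L l)) (mmul (resid d L lam y V) (tr (prodW d V (l - 1))) (d 0)) (d L)" for l
  have h: "hgrad d L lam y V l = (\<lambda>i j. M l i j + lam * V l i j)" for l
    by (simp add: hgrad_def M_def)
  have pl: "prodW d V l = mmul (V l) (prodW d V (l - 1)) (d (l - 1))"
    using assms(1) by (cases l) auto
  \<comment> \<open>The data parts \<open>W_{l+1}^T M_{l+1}\<close> and \<open>M_l W_l^T\<close> are
    the same matrix \<open>(W_L ... W_{l+1})^T E (W_l ... W_1)^T\<close>, so only the regularizer is
    left in the difference.\<close>
  have "mmul (tr (V (Suc l))) (M (Suc l)) (d (Suc l)) i j
      = mmul (tr (mmul (prodL d V L (Suc l)) (V (Suc l)) (d (Suc l))))
          (mmul (resid d L lam y V) (tr (prodW d V l)) (d 0)) (d L) i j"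
    by (simp add: M_def tr_mmul mmul_assoc)
  also have "\<dots> = mmul (tr (prodL d V L l)) (mmul (resid d L lam y V) (tr (prodW d V l)) (d 0)) (d L) i j"
    by (rule mmul_cong) (use assms in \<open>auto simp: tr_def prodL_rec\<close>)
  also have "\<dots> = mmul (M l) (tr (V l)) (d (l - 1)) i j"
    by (simp add: M_def pl tr_mmul mmul_assoc)
  finally show ?thesis
    unfolding h mmul_add_left mmul_add_right mmul_scale_left mmul_scale_right
    by (simp add: algebra_simps)
qed

lemma negligible_mmul:
  assumes "\<And>k. k < m \<Longrightarrow> (\<lambda>n. A n i k) \<longlonglongrightarrow> A0 k" "\<And>k. k < m \<Longrightarrow> (\<lambda>n. B n k j / t n) \<longlonglongrightarrow> 0"
  shows "(\<lambda>n. mmul (A n) (B n) m i j / t n) \<longlonglongrightarrow> 0"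
proof -
  have "(\<lambda>n. \<Sum>k<m. A n i k * (B n k j / t n)) \<longlonglongrightarrow> (\<Sum>k<m. A0 k * 0)"
    by (intro tendsto_sum tendsto_mult assms) auto
  then show ?thesis by (simp add: mmul_def sum_divide_distrib)
qed

text \<open>\<open>balance_identity\<close> makes \<open>lam\<close> times the imbalance of
  \<open>W n\<close> an \<open>o(t)\<close>, since the gradient is \<open>o(t)\<close> and the
  layers converge. The equation is the vanishing of the linear term of
  \<open>W_{l+1}^T W_{l+1} - W_l W_l^T\<close>.\<close>

lemma linearized_balance:
  assumes l: "1 \<le> l" "l < L" "i < d l" "j < d l"
  shows "b i * X (Suc l) i j + b j * X (Suc l) j i = b j * X l i j + b i * X l j i"
proof -
  define U where "U n = mmul (tr (W n (Suc l))) (W n (Suc l)) (d (Suc l)) i j" for n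
  define V where "V n = mmul (W n l) (tr (W n l)) (d (l - 1)) i j" for n
  have sym: "diagm b k i = diagm b i k" for i k by (auto simp: diagm_def)
  have U: "expands t U (mmul (diagm b) (diagm b) (d (Suc l)) i j)
     (mmul (tr (X (Suc l))) (diagm b) (d (Suc l)) i j + mmul (diagm b) (X (Suc l)) (d (Suc l)) i j)"
    unfolding U_def
  proof (rule expands_mmul)
    fix k assume k: "k < d (Suc l)"
    show "expands t (\<lambda>n. tr (W n (Suc l)) i k) (diagm b i k) (tr (X (Suc l)) i k)"
      using expW[of "Suc l" k i] l k by (simp add: tr_def sym[of k i])
    show "expands t (\<lambda>n. W n (Suc l) k j) (diagm b k j) (X (Suc l) k j)"
      using expW[of "Suc l" k j] l k by simp
  qed
  have V: "expands t V (mmul (diagm b) (diagm b) (d (l - 1)) i j)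
     (mmul (X l) (diagm b) (d (l - 1)) i j + mmul (diagm b) (tr (X l)) (d (l - 1)) i j)"
    unfolding V_def
  proof (rule expands_mmul)
    fix k assume k: "k < d (l - 1)"
    show "expands t (\<lambda>n. tr (W n l) k j) (diagm b k j) (tr (X l) k j)"
      using expW[of l j k] l k by (simp add: tr_def sym[of k j])
    show "expands t (\<lambda>n. W n l i k) (diagm b i k) (X l i k)"
      using expW[of l i k] l k by simp
  qed
  have lim1: "(\<lambda>n. mmul (tr (W n (Suc l))) (hgrad d L lam y (W n) (Suc l)) (d (Suc l)) i j / t n) \<longlonglongrightarrow> 0"
  proof (rule negligible_mmul)
    fix k assume k: "k < d (Suc l)"
    show "(\<lambda>n. tr (W n (Suc l)) i k) \<longlonglongrightarrow> diagm b k i"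
      using expands_tendsto[OF expW[of "Suc l" k i]] l k by (simp add: tr_def)
    show "(\<lambda>n. hgrad d L lam y (W n) (Suc l) k j / t n) \<longlonglongrightarrow> 0"
      using critical[of "Suc l" k j] l k by simp
  qed
  \<comment> \<open>Transposed at first, because \<open>negligible_mmul\<close> expects the
    convergent factor on the left and the small one on the right.\<close>
  have "(\<lambda>n. mmul (W n l) (tr (hgrad d L lam y (W n) l)) (d (l - 1)) j i / t n) \<longlonglongrightarrow> 0"
  proof (rule negligible_mmul)
    fix k assume k: "k < d (l - 1)"
    show "(\<lambda>n. W n l j k) \<longlonglongrightarrow> diagm b j k"
      using expands_tendsto[OF expW[of l j k]] l k by simp
    show "(\<lambda>n. tr (hgrad d L lam y (W n) l) k i / t n) \<longlonglongrightarrow> 0"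
      using critical[of l i k] l k by (simp add: tr_def)
  qed
  moreover have "mmul A (tr B) m j i = mmul B (tr A) m i j" for A B m
    by (simp add: mmul_def tr_def mult.commute)
  ultimately have lim2: "(\<lambda>n. mmul (hgrad d L lam y (W n) l) (tr (W n l)) (d (l - 1)) i j / t n) \<longlonglongrightarrow> 0"
    by simp
  have "lam * (U n - V n) / t n
      = mmul (tr (W n (Suc l))) (hgrad d L lam y (W n) (Suc l)) (d (Suc l)) i j / t n
        - mmul (hgrad d L lam y (W n) l) (tr (W n l)) (d (l - 1)) i j / t n" for n
    unfolding U_def V_def balance_identity[OF l] by (simp add: diff_divide_distrib)
  then have "(\<lambda>n. lam * (U n - V n) / t n) \<longlonglongrightarrow> 0"
    using tendsto_diff[OF lim1 lim2] by simp
  from expands_negligible[OF expands_cmult[OF expands_diff[OF U V]] this]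
  have "mmul (tr (X (Suc l))) (diagm b) (d (Suc l)) i j + mmul (diagm b) (X (Suc l)) (d (Suc l)) i j
     = mmul (X l) (diagm b) (d (l - 1)) i j + mmul (diagm b) (tr (X l)) (d (l - 1)) i j"
    using lam by simp
  moreover have "b i = 0" if "d k \<le> i" "k \<le> L" for i k using bd that by blast
  then have z: "(if i < d k then b i * x else 0) = b i * x" "(if i < d k then x * b i else 0) = x * b i"
    if "k \<le> L" for i k x using that by (auto simp: not_less)
  have "Suc l \<le> L" "l - 1 \<le> L" using l by auto
  ultimately show ?thesis
    by (simp only: mmul_diagm_left mmul_diagm_right z tr_apply) (simp add: mult.commute)
qed

end

section \<open>The error bound on a slice\<close>

context infinitesimal begin

lemma expands_unique: "expands t f c f' \<Longrightarrow> expands t f c f'' \<Longrightarrow> f' = f''"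
  unfolding expands_def by (rule LIMSEQ_unique)

end

text \<open>\<open>W - diag(b)\<close> is orthogonal to the orbit of \<open>diag(b)\<close>: the first family of conditions comes
  from rotations of the hidden layers, the second from simultaneous rotations of the outer layers.
  Only off-diagonal entries occur, so \<open>diag(b)\<close> does not show up.\<close>
definition in_slice :: "(nat \<Rightarrow> nat) \<Rightarrow> nat \<Rightarrow> (nat \<Rightarrow> real) \<Rightarrow> (nat \<Rightarrow> real) \<Rightarrow> (nat \<Rightarrow> mat) \<Rightarrow> bool" where
  "in_slice d L y b W \<longleftrightarrow>
    (\<forall>l i j. 1 \<le> l \<and> l < L \<and> i < d l \<and> j < d l \<and> i \<noteq> j \<longrightarrow>
      b j * W l i j - b i * W l j i + b j * W (Suc l) j i - b i * W (Suc l) i j = 0) \<and>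
    (\<forall>i j. i < dmin d L \<and> j < dmin d L \<and> i \<noteq> j \<and> y i = y j \<and> y i > 0 \<longrightarrow>
      b i * W 1 i j - b j * W 1 j i + b i * W L j i - b j * W L i j = 0)"

locale critical_diag =
  fixes d :: "nat \<Rightarrow> nat" and L :: nat and lam :: real and y b :: "nat \<Rightarrow> real"
  assumes L2: "L \<ge> 2" and lam: "lam > 0" and width: "\<And>l. l \<le> L \<Longrightarrow> dmin d L \<le> d l"
    and y0: "\<And>i. i < dmin d L \<Longrightarrow> y i \<ge> 0"
    and b0: "\<And>i. b i \<ge> 0" and bN: "\<And>i. dmin d L \<le> i \<Longrightarrow> b i = 0"
    and crit: "\<And>i. i < dmin d L \<Longrightarrow> b i ^ (2 * L - 1) - sqrt lam * y i * b i ^ (L - 1) + lam * b i = 0"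
    and nondeg0: "\<And>i. i < dmin d L \<Longrightarrow> L = 2 \<Longrightarrow> sqrt lam * y i \<noteq> lam"
    and nondeg: "\<And>i. b i > 0 \<Longrightarrow> real L * b i ^ (2 * L - 2) \<noteq> lam * (real L - 2)"
begin

text \<open>The slice conditions are linear and involve no diagonal entries, so they pass from
  \<open>W n\<close> to \<open>X\<close>. Together with the linearized gradient they meet all
  assumptions of \<open>kernel\<close>.\<close>

lemma tangent_trivial:
  assumes "tangent_sequence t d L lam y b W X"
    and slice: "\<And>n. in_slice d L y b (W n)"
    and outside: "\<And>l i j. (l, i, j) \<notin> idx d L \<Longrightarrow> X l i j = 0"
  shows "X l i j = 0"
proof -
  interpret tangent_sequence t d L lam y b W X by fact
  \<comment> \<open>The slice conditions may mention entries out of range, for which no expansion is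
    known. Their coefficient is an entry of \<open>b\<close> that is zero.\<close>
  have entry: "expands t (\<lambda>n. c * W n l i j) 0 (c * X l i j)"
    if "1 \<le> l" "l \<le> L" "i \<noteq> j" "d l \<le> i \<or> d (l - 1) \<le> j \<Longrightarrow> c = 0" for c l i j
  proof (cases "d l \<le> i \<or> d (l - 1) \<le> j")
    case True
    then show ?thesis using that by (simp add: expands_const[of 0])
  next
    case False
    then show ?thesis using expands_cmult[OF expW[of l i j], of c] that
      by (simp add: diagm_def not_le)
  qed
  have bz: "b i = 0" if "d k \<le> i" "k \<le> L" for i k using bd that by blast
  have gen1: "b j * X l i j - b i * X l j i + b j * X (Suc l) j i - b i * X (Suc l) i j = 0"
    if l: "1 \<le> l" "l < L" "i < d l" "j < d l" "i \<noteq> j" for l i j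
  proof -
    have "expands t (\<lambda>n. b j * W n l i j - b i * W n l j i + b j * W n (Suc l) j i - b i * W n (Suc l) i j)
       (0 - 0 + 0 - 0) (b j * X l i j - b i * X l j i + b j * X (Suc l) j i - b i * X (Suc l) i j)"
      by (intro expands_add expands_diff entry) (use l in \<open>auto intro: bz[of "l - 1"] bz[of "Suc l"]\<close>)
    moreover have "(\<lambda>n. b j * W n l i j - b i * W n l j i + b j * W n (Suc l) j i - b i * W n (Suc l) i j) = (\<lambda>_. 0)"
      using slice l unfolding in_slice_def by blast
    ultimately show ?thesis by (intro expands_unique[OF _ expands_const[of 0]]) simp
  qed
  have gen2: "b i * X 1 i j - b j * X 1 j i + b i * X L j i - b j * X L i j = 0"
    if l: "i < dmin d L" "j < dmin d L" "i \<noteq> j" "y i = y j" "y i > 0" for i j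
  proof -
    have "i < d l" "j < d l" if "l \<le> L" for l using l width[OF that] by auto
    then have "\<not> d l \<le> i" "\<not> d l \<le> j" if "l \<le> L" for l using that by (auto simp: not_le)
    then have "expands t (\<lambda>n. b i * W n 1 i j - b j * W n 1 j i + b i * W n L j i - b j * W n L i j)
       (0 - 0 + 0 - 0) (b i * X 1 i j - b j * X 1 j i + b i * X L j i - b j * X L i j)"
      by (intro expands_add expands_diff entry) (use l L2 in auto)
    moreover have "(\<lambda>n. b i * W n 1 i j - b j * W n 1 j i + b i * W n L j i - b j * W n L i j) = (\<lambda>_. 0)"
      using slice l unfolding in_slice_def by blast
    ultimately show ?thesis by (intro expands_unique[OF _ expands_const[of 0]]) simp
  qed
  have out: "X l i j = 0" if "d l \<le> i \<or> d (l - 1) \<le> j" for l i j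
    using outside[of l i j] that by (auto simp: idx_def)
  interpret kernel d L "dmin d L" lam b Y X
  proof
    show "L \<ge> 2" "lam > 0" "\<And>l. l \<le> L \<Longrightarrow> dmin d L \<le> d l" "\<And>i. b i \<ge> 0"
      "\<And>i. dmin d L \<le> i \<Longrightarrow> b i = 0"
      using L2 lam width b0 bN by auto
    show "Y i \<ge> 0" for i using y0 lam by (simp add: Y_def)
    show "Y i = 0" if "dmin d L \<le> i" for i using that by (simp add: Y_def)
    show "b i ^ (2 * L - 1) - Y i * b i ^ (L - 1) + lam * b i = 0" for i
      using crit[of i] bN[of i] L2 by (cases "i < dmin d L") (auto simp: Y_def)
    show "Y i \<noteq> lam" if "L = 2" for i
      using nondeg0[OF _ that, of i] lam unfolding Y_def by auto
    show "real L * b i ^ (2 * L - 2) \<noteq> lam * (real L - 2)" if "b i > 0" for i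
      by (rule nondeg[OF that])
    show "X l i j = 0" if "d l \<le> i \<or> d (l - 1) \<le> j" for l i j
      using that by (rule out)
    \<comment> \<open>Off the diagonal, subtract the slice condition \<open>gen1\<close> from the
      balance equation: the terms at \<open>(j, i)\<close> cancel and those at \<open>(i, j)\<close>
      double. On the diagonal, balance alone is enough.\<close>
    show "b i * X (Suc l) i j = b j * X l i j" if "1 \<le> l" "l < L" "i < d l" "j < d l" for l i j
    proof (cases "i = j")
      case True
      then show ?thesis using linearized_balance[OF that] by simp
    next
      case False
      then show ?thesis using linearized_balance[OF that] gen1[OF that] by linarith
    qed
    show "b i * X 1 i j - b j * X 1 j i + b i * X L j i - b j * X L i j = 0"
      if "i < dmin d L" "j < dmin d L" "i \<noteq> j" "Y i = Y j" "Y i > 0" for i j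
      using gen2[of i j] that lam by (auto simp: Y_def zero_less_mult_iff)
  qed (rule linearized_gradient)
  show ?thesis
    using kernel_trivial[of l i j] assms(3)[of l i j] by (cases "1 \<le> l \<and> l \<le> L") (auto simp: idx_def)
qed

lemma abs_hgrad_le:
  assumes "1 \<le> l" "l \<le> L" "i < d l" "j < d (l - 1)"
  shows "\<bar>hgrad d L lam y V l i j\<bar> \<le> gradG_norm d L lam y V"
proof -
  have "(\<lambda>(l, i, j). (partialG d L lam y V l i j)\<^sup>2) (l, i, j)
      \<le> (\<Sum>x\<in>idx d L. (\<lambda>(l, i, j). (partialG d L lam y V l i j)\<^sup>2) x)"
    by (rule member_le_sum[OF _ _ finite_idx]) (use assms in \<open>auto simp: idx_def\<close>)
  then have "\<bar>partialG d L lam y V l i j\<bar> \<le> gradG_norm d L lam y V"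
    unfolding gradG_norm_def by (simp add: real_le_rsqrt)
  then show ?thesis by (simp add: partialG_eq[OF assms])
qed

text \<open>By contradiction: counterexamples approaching \<open>diag(b)\<close>, rescaled to unit distance,
  accumulate at a unit vector in the kernel of the Hessian that is orthogonal to the orbit.\<close>
lemma slice_error_bound:
  "\<exists>K. \<forall>n\<ge>K. \<forall>W. in_slice d L y b W \<longrightarrow> frob_dist d L W (\<lambda>_. diagm b) \<le> 1 / real (Suc n) \<longrightarrow>
     frob_dist d L W (\<lambda>_. diagm b) \<le> real (Suc n) * gradG_norm d L lam y W"
proof (rule ccontr)
  assume "\<not> ?thesis"
  then have "\<forall>K. \<exists>n W. n \<ge> K \<and> in_slice d L y b W \<and> frob_dist d L W (\<lambda>_. diagm b) \<le> 1 / real (Suc n)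
     \<and> frob_dist d L W (\<lambda>_. diagm b) > real (Suc n) * gradG_norm d L lam y W"
    by (meson not_le)
  then obtain n W where n: "\<And>k. n k \<ge> k" and slice: "\<And>k. in_slice d L y b (W k)"
    and close: "\<And>k. frob_dist d L (W k) (\<lambda>_. diagm b) \<le> 1 / real (Suc (n k))"
    and bad: "\<And>k. frob_dist d L (W k) (\<lambda>_. diagm b) > real (Suc (n k)) * gradG_norm d L lam y (W k)"
    by metis
  define T where "T k = frob_dist d L (W k) (\<lambda>_. diagm b)" for k
  have inv: "1 / real (Suc (n k)) \<le> 1 / real (Suc k)" for k
    using n[of k] by (intro divide_left_mono) auto
  have g0: "gradG_norm d L lam y V \<ge> 0" for V
    by (simp add: gradG_norm_def sum_nonneg split_def)
  \<comment> \<open>The counterexample inequality is strict and its right side nonnegative, so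
    rescaling by the distance is legitimate.\<close>
  have Tpos: "T k > 0" for k
    using bad[of k] g0[of "W k"] by (simp add: T_def order_le_less_trans[rotated])
  have Tle: "T k \<le> 1 / real (Suc k)" for k using close[of k] inv[of k] by (simp add: T_def)
  have Tlim: "T \<longlonglongrightarrow> 0"
    by (rule tendsto_sandwich[OF _ _ tendsto_const LIMSEQ_Suc[OF lim_1_over_n]])
      (use Tpos Tle in \<open>auto simp: less_imp_le\<close>)
  have grad: "gradG_norm d L lam y (W k) / T k \<le> 1 / real (Suc k)" for k
  proof -
    have "real (Suc (n k)) * gradG_norm d L lam y (W k) \<le> T k" using bad[of k] by (simp add: T_def)
    then have "gradG_norm d L lam y (W k) / T k \<le> 1 / real (Suc (n k))"
      using Tpos[of k] by (simp add: divide_simps mult.commute)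
    then show ?thesis using inv[of k] by linarith
  qed
  \<comment> \<open>Entries outside \<open>idx\<close> are set to zero, so that \<open>u k\<close>
    lies in the compact box and its limit vanishes there, as \<open>tangent_trivial\<close>
    requires.\<close>
  define u where "u k l i j = (if (l, i, j) \<in> idx d L then (W k l i j - diagm b i j) / T k else 0)" for k l i j
  have usum: "(\<Sum>(l, i, j)\<in>idx d L. (u k l i j)\<^sup>2) = 1" for k
  proof -
    have "(\<Sum>(l, i, j)\<in>idx d L. (u k l i j)\<^sup>2)
        = (\<Sum>(l, i, j)\<in>idx d L. (W k l i j - diagm b i j)\<^sup>2) / (T k)\<^sup>2"
      unfolding sum_divide_distrib by (rule sum.cong) (auto simp: u_def power_divide)
    also have "(\<Sum>(l, i, j)\<in>idx d L. (W k l i j - diagm b i j)\<^sup>2) = (T k)\<^sup>2"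
      unfolding T_def frob_dist_def by (simp add: sum_nonneg split_def)
    finally show ?thesis using Tpos[of k] by simp
  qed
  have ubound: "u k l i j \<in> {-1..1}" for k l i j
  proof (cases "(l, i, j) \<in> idx d L")
    case True
    then have "(\<lambda>(l, i, j). (u k l i j)\<^sup>2) (l, i, j) \<le> (\<Sum>x\<in>idx d L. (\<lambda>(l, i, j). (u k l i j)\<^sup>2) x)"
      by (intro member_le_sum) (auto simp: finite_idx)
    then have "(u k l i j)\<^sup>2 \<le> 1" by (simp add: usum)
    then have "\<bar>u k l i j\<bar> \<le> 1" by (simp add: abs_square_le_1)
    then show ?thesis by auto
  qed (simp add: u_def)
  \<comment> \<open>Compactness yields convergent subsequences because the index types are
    countable, which makes the product topology first countable.\<close>
  obtain X \<phi> where \<phi>: "strict_mono \<phi>" and lim: "(u \<circ> \<phi>) \<longlonglongrightarrow> X"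
    using compact_imp_seq_compact[OF compact_unit_tensors] ubound
    by (auto elim!: seq_compactE[where f = u])
  have limX: "(\<lambda>k. u (\<phi> k) l i j) \<longlonglongrightarrow> X l i j" for l i j
    using tendsto_entries[OF lim, of l i j] by simp
  have X0: "X l i j = 0" for l i j
  proof (rule tangent_trivial)
    show "in_slice d L y b (W (\<phi> k))" for k by (rule slice)
    show "X l i j = 0" if "(l, i, j) \<notin> idx d L" for l i j
      using limX[of l i j] that by (simp add: u_def LIMSEQ_const_iff)
    show "tangent_sequence (T \<circ> \<phi>) d L lam y b (\<lambda>k. W (\<phi> k)) X"
    proof
      show "(T \<circ> \<phi>) k > 0" for k using Tpos by simp
      show "(T \<circ> \<phi>) \<longlonglongrightarrow> 0" by (rule LIMSEQ_subseq_LIMSEQ[OF Tlim \<phi>])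
      show "b i = 0" if "l \<le> L" "d l \<le> i" for l i using bN width that le_trans by blast
      show "lam > 0" "1 \<le> L" using lam L2 by auto
      fix l i j assume l: "1 \<le> l" "l \<le> L" "i < d l" "j < d (l - 1)"
      then have "u k l i j = (W k l i j - diagm b i j) / T k" for k by (simp add: u_def idx_def)
      then show "expands (T \<circ> \<phi>) (\<lambda>k. W (\<phi> k) l i j) (diagm b i j) (X l i j)"
        using limX[of l i j] by (simp add: expands_def)
      have "(\<lambda>k. hgrad d L lam y (W k) l i j / T k) \<longlonglongrightarrow> 0"
      proof (rule tendsto_rabs_zero_cancel, rule tendsto_sandwich[OF _ _ tendsto_const LIMSEQ_Suc[OF lim_1_over_n]])
        have "\<bar>hgrad d L lam y (W k) l i j / T k\<bar> \<le> 1 / real (Suc k)" for k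
        proof -
          have "\<bar>hgrad d L lam y (W k) l i j / T k\<bar> \<le> gradG_norm d L lam y (W k) / T k"
            using abs_hgrad_le[OF l, of "W k"] Tpos[of k] by (simp add: divide_right_mono)
          then show ?thesis using grad[of k] by linarith
        qed
        then show "\<forall>\<^sub>F k in sequentially. \<bar>hgrad d L lam y (W k) l i j / T k\<bar> \<le> 1 / real (Suc k)"
          by (intro always_eventually allI)
      qed simp
      from LIMSEQ_subseq_LIMSEQ[OF this \<phi>]
      show "(\<lambda>k. hgrad d L lam y (W (\<phi> k)) l i j / (T \<circ> \<phi>) k) \<longlonglongrightarrow> 0"
        by (simp add: o_def)
    qed
  qed
  have "(\<lambda>k. \<Sum>(l, i, j)\<in>idx d L. (u (\<phi> k) l i j)\<^sup>2) \<longlonglongrightarrow> (\<Sum>(l, i, j)\<in>idx d L. (X l i j)\<^sup>2)"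
    unfolding split_def by (intro tendsto_intros limX)
  then show False
    by (simp add: usum X0 LIMSEQ_const_iff)
qed

end

section \<open>Frames and nearest points\<close>

lemma orthogonal_mat_idm: "orthogonal_mat n idm"
  by (simp add: orthogonal_mat_iff mmul_idm_right)

lemma orthogonal_mat_cong:
  assumes "\<And>i j. i < n \<Longrightarrow> j < n \<Longrightarrow> A i j = B i j"
  shows "orthogonal_mat n A = orthogonal_mat n B"
  using assms by (simp add: orthogonal_mat_def)

lemma orthogonal_mat_bound:
  assumes "orthogonal_mat n A" "i < n" "j < n"
  shows "A i j \<in> {-1..1}"
proof -
  have "(A i j)\<^sup>2 \<le> (\<Sum>k<n. (A k j)\<^sup>2)"
    by (rule member_le_sum) (use assms in auto)
  also have "\<dots> = 1" using assms by (simp add: orthogonal_mat_def power2_eq_square)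
  finally have "\<bar>A i j\<bar> \<le> 1" by (simp add: abs_square_le_1)
  then show ?thesis by auto
qed

section \<open>Plane rotations and the group of frames\<close>

definition givens :: "nat \<Rightarrow> nat \<Rightarrow> real \<Rightarrow> mat" where
  "givens p q \<theta> = (\<lambda>i j. if i = p \<and> j = q then - sin \<theta> else if i = q \<and> j = p then sin \<theta>
     else if i = j then (if i = p \<or> i = q then cos \<theta> else 1) else 0)"

lemma orthogonal_mat_givens:
  assumes "p < n" "q < n" "p \<noteq> q"
  shows "orthogonal_mat n (givens p q \<theta>)"
  unfolding orthogonal_mat_def
proof (intro allI impI)
  fix i j assume ij: "i < n" "j < n"
  let ?g = "givens p q \<theta>"
  have split: "{..<n} = insert p (insert q ({..<n} - {p, q}))" using assms by auto
  have "(\<Sum>k<n. ?g k i * ?g k j)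
     = ?g p i * ?g p j + (?g q i * ?g q j + (\<Sum>k\<in>{..<n} - {p, q}. ?g k i * ?g k j))"
    by (subst split) (use assms in simp)
  also have "(\<Sum>k\<in>{..<n} - {p, q}. ?g k i * ?g k j)
     = (\<Sum>k\<in>{..<n} - {p, q}. if k = i then (if i = j then 1 else 0) else 0)"
    by (rule sum.cong) (auto simp: givens_def)
  also have "\<dots> = (if i = j \<and> i \<noteq> p \<and> i \<noteq> q then 1 else 0)"
    using ij by (simp add: sum.delta)
  finally show "(\<Sum>k<n. ?g k i * ?g k j) = (if i = j then 1 else 0)"
    using assms(3) by (auto simp: givens_def power2_eq_square[symmetric])
qed

lemma givens_0: "p \<noteq> q \<Longrightarrow> givens p q 0 = idm"
  by (auto simp: givens_def idm_def fun_eq_iff)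

definition rot_gen :: "nat \<Rightarrow> nat \<Rightarrow> mat" where
  "rot_gen p q = (\<lambda>i j. if i = p \<and> j = q then - 1 else if i = q \<and> j = p then 1 else 0)"

lemma DERIV_givens: "((\<lambda>\<theta>. givens p q \<theta> i j) has_real_derivative rot_gen p q i j) (at 0)"
proof -
  have "(\<lambda>\<theta>. givens p q \<theta> i j) = (if i = p \<and> j = q then (\<lambda>\<theta>. - sin \<theta>) else if i = q \<and> j = p then sin
     else if i = j \<and> (i = p \<or> i = q) then cos else (\<lambda>_. if i = j then 1 else 0))"
    by (auto simp: givens_def fun_eq_iff)
  \<comment> \<open>Written with \<open>cos 0\<close> and \<open>sin 0\<close> so that each branch
    has the exact form of the derivative rule that settles it.\<close>
  moreover have "rot_gen p q i j = (if i = p \<and> j = q then - cos 0 else if i = q \<and> j = p then cos 0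
     else if i = j \<and> (i = p \<or> i = q) then - sin 0 else 0)"
    by (simp add: rot_gen_def)
  moreover have "((\<lambda>\<theta>. - sin \<theta>) has_real_derivative - cos 0) (at (0::real))"
    by (rule DERIV_minus[OF DERIV_sin])
  ultimately show ?thesis
    by (simp only: DERIV_sin DERIV_cos DERIV_const split: if_split) blast
qed

lemma same_block_trans: "same_block y r i j \<Longrightarrow> same_block y r j k \<Longrightarrow> same_block y r i k"
  by (auto simp: same_block_def)

lemma same_block_sym: "same_block y r i j \<Longrightarrow> same_block y r j i"
  by (auto simp: same_block_def)

text \<open>The orthogonal symmetries of \<open>G\<close>. In terms of \<open>Wset\<close>,
  \<open>R 0\<close> is \<open>V^T\<close> and \<open>R L\<close> is \<open>U\<close>; the agreement
  of their top left blocks is the sharing of \<open>O_1, ..., O_{p_Y}\<close>. Entries out of range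
  are free, so this set is closed but not compact.\<close>

definition frames :: "(nat \<Rightarrow> nat) \<Rightarrow> nat \<Rightarrow> (nat \<Rightarrow> real) \<Rightarrow> nat \<Rightarrow> (nat \<Rightarrow> mat) set" where
  "frames d L y r = {R. (\<forall>l\<le>L. orthogonal_mat (d l) (R l)) \<and>
     blockdiag_orth y r (d 0) (R 0) \<and> blockdiag_orth y r (d L) (R L) \<and>
     (\<forall>i<r. \<forall>j<r. R L i j = R 0 i j)}"

lemma frames_orth: "R \<in> frames d L y r \<Longrightarrow> l \<le> L \<Longrightarrow> orthogonal_mat (d l) (R l)"
  by (simp add: frames_def)

lemma blockdiag_orth_mmul:
  assumes "blockdiag_orth y r m A" "blockdiag_orth y r m B"
  shows "blockdiag_orth y r m (mmul A B m)"
  unfolding blockdiag_orth_def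
proof (intro conjI allI impI)
  show "orthogonal_mat m (mmul A B m)"
    using assms by (simp add: blockdiag_orth_def orthogonal_mat_mmul)
  fix i j assume ij: "i < m" "j < m" "\<not> same_block y r i j"
  have "A i k * B k j = 0" if "k < m" for k
    using assms ij that same_block_trans[of y r i k j] unfolding blockdiag_orth_def by fastforce
  then show "mmul A B m i j = 0" unfolding mmul_def by (intro sum.neutral) auto
qed

text \<open>No block straddles \<open>r\<close>, so the first \<open>r\<close> rows see only the
  first \<open>r\<close> columns. Thus the common top left block of \<open>R 0\<close> and
  \<open>R L\<close> survives multiplication of frames, although \<open>d 0\<close> and
  \<open>d L\<close> differ.\<close>

lemma blockdiag_orth_restrict:
  assumes "blockdiag_orth y r m A" "r \<le> m" "i < r"
  shows "mmul A B m i j = mmul A B r i j"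
proof -
  have "A i k = 0" if "r \<le> k" "k < m" for k
    using assms that by (auto simp: blockdiag_orth_def same_block_def)
  then show ?thesis
    unfolding mmul_def using assms by (intro sum.mono_neutral_right) auto
qed

lemma frames_mmul:
  assumes R: "R \<in> frames d L y r" and G: "G \<in> frames d L y r" and r: "r \<le> d 0" "r \<le> d L"
  shows "(\<lambda>l. mmul (R l) (G l) (d l)) \<in> frames d L y r"
  unfolding frames_def
proof (intro CollectI conjI allI impI)
  fix i j assume ij: "i < r" "j < r"
  have "mmul (R L) (G L) (d L) i j = mmul (R L) (G L) r i j"
    using R r ij by (intro blockdiag_orth_restrict) (auto simp: frames_def)
  also have "\<dots> = mmul (R 0) (G 0) r i j"
    by (rule mmul_cong) (use R G ij in \<open>auto simp: frames_def\<close>)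
  also have "\<dots> = mmul (R 0) (G 0) (d 0) i j"
    using R r ij by (intro blockdiag_orth_restrict[symmetric]) (auto simp: frames_def)
  finally show "mmul (R L) (G L) (d L) i j = mmul (R 0) (G 0) (d 0) i j" .
qed (use assms in \<open>auto simp: frames_def orthogonal_mat_mmul blockdiag_orth_mmul\<close>)

text \<open>\<open>Z\<close> is the set of layer spaces rotated at once: hidden spaces freely, the
  two outer ones only together and within one block of \<open>y\<close>.\<close>

lemma rotation_in_frames:
  assumes pq: "p \<noteq> q" and Z: "\<And>l. l \<in> Z \<Longrightarrow> p < d l \<and> q < d l"
    and hid: "(0 \<notin> Z \<and> L \<notin> Z) \<or> (0 \<in> Z \<and> L \<in> Z \<and> same_block y r p q)"
  shows "(\<lambda>l. if l \<in> Z then givens p q \<theta> else idm) \<in> frames d L y r"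
proof -
  have "orthogonal_mat (d l) (if l \<in> Z then givens p q \<theta> else idm)" for l
    using Z[of l] pq by (simp add: orthogonal_mat_givens orthogonal_mat_idm)
  moreover have "givens p q \<theta> i j = 0" if "same_block y r p q" "\<not> same_block y r i j" for i j
    using that same_block_sym[of y r p q] by (auto simp: givens_def same_block_def)
  moreover have "idm i j = 0" if "\<not> same_block y r i j" for i j
    using that by (auto simp: idm_def same_block_def)
  ultimately show ?thesis
    using hid by (auto simp: frames_def blockdiag_orth_def)
qed

lemma continuous_entry: "continuous_on UNIV (\<lambda>R :: nat \<Rightarrow> mat. R l i j)"
proof -
  have *: "continuous_on UNIV (\<lambda>R. h R i)" if "continuous_on UNIV h"
    for h :: "'a::topological_space \<Rightarrow> 'c \<Rightarrow> 'd::topological_space" and i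
    using continuous_on_product_then_coordinatewise[OF that] .
  show ?thesis by (rule *[OF *[OF *[OF continuous_on_id]]])
qed

lemma closed_frames: "closed (frames d L y r)"
proof -
  have c: "closed {R :: nat \<Rightarrow> mat. f R = g R}"
    if "continuous_on UNIV f" "continuous_on UNIV g" for f g :: "(nat \<Rightarrow> mat) \<Rightarrow> real"
    using that by (rule closed_Collect_eq)
  have i: "closed {R :: nat \<Rightarrow> mat. P \<longrightarrow> Q R}" if "closed {R. Q R}" for P Q
    using that by (cases P) auto
  show ?thesis
    unfolding frames_def blockdiag_orth_def orthogonal_mat_def
    by (intro closed_Collect_conj closed_Collect_all i c continuous_intros continuous_entry)
qed

lemma continuous_frob_dist_act:
  "continuous_on UNIV (\<lambda>R. frob_dist d L W (act d R V))"
  unfolding frob_dist_def act_def mmul_def tr_def split_def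
  by (intro continuous_intros continuous_entry)

text \<open>The minimum is taken over the compact set of frames with all entries in
  \<open>[-1, 1]\<close>. An arbitrary frame is compared after truncation to zero out of range:
  orthogonality bounds the remaining entries, and the distance does not change.\<close>

lemma nearest_frame:
  assumes r: "r \<le> d 0" "r \<le> d L"
  obtains R where "R \<in> frames d L y r"
    "\<And>R'. R' \<in> frames d L y r \<Longrightarrow> frob_dist d L W (act d R V) \<le> frob_dist d L W (act d R' V)"
proof -
  define K where "K = {f :: nat \<Rightarrow> mat. \<forall>l i j. f l i j \<in> {-1..1}} \<inter> frames d L y r"
  have "compact K" unfolding K_def using compact_unit_tensors closed_frames by (rule compact_Int_closed)
  moreover have "(\<lambda>_. idm) \<in> K"
    using rotation_in_frames[of 0 1 "{}" d L y r] by (auto simp: idm_def K_def)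
  then have "K \<noteq> {}" by auto
  moreover have "continuous_on K (\<lambda>R. frob_dist d L W (act d R V))"
    by (rule continuous_on_subset[OF continuous_frob_dist_act]) simp
  ultimately obtain R where R: "R \<in> K"
    "\<And>R'. R' \<in> K \<Longrightarrow> frob_dist d L W (act d R V) \<le> frob_dist d L W (act d R' V)"
    using continuous_attains_inf[of K "\<lambda>R. frob_dist d L W (act d R V)"] by blast
  show ?thesis
  proof
    show "R \<in> frames d L y r" using R by (simp add: K_def)
    fix R' assume R': "R' \<in> frames d L y r"
    define T where "T = (\<lambda>l i j. if l \<le> L \<and> i < d l \<and> j < d l then R' l i j else 0)"
    have T: "T l i j = R' l i j" if "l \<le> L" "i < d l" "j < d l" for l i j
      using that by (simp add: T_def)
    have oT: "orthogonal_mat (d l) (T l)" if "l \<le> L" for l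
      using orthogonal_mat_cong[of "d l" "T l" "R' l"] frames_orth[OF R' that] T that by simp
    have "T \<in> frames d L y r"
      using R' r oT by (auto simp: frames_def blockdiag_orth_def T)
    moreover have "T l i j \<in> {-1..1}" for l i j
      using orthogonal_mat_bound[OF frames_orth[OF R', of l], of i j] by (auto simp: T_def)
    ultimately have "frob_dist d L W (act d R V) \<le> frob_dist d L W (act d T V)"
      by (intro R(2)) (simp add: K_def)
    also have "\<dots> = frob_dist d L W (act d R' V)"
    proof (rule frob_dist_cong)
      fix l i j assume l: "1 \<le> l" "l \<le> L" "i < d l" "j < d (l - 1)"
      have "l - 1 \<le> L" using l by simp
      then show "act d T V l i j = act d R' V l i j"
        unfolding act_def using l by (intro mmul_cong) (auto simp: T tr_def)
    qed simp
    finally show "frob_dist d L W (act d R V) \<le> frob_dist d L W (act d R' V)" .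
  qed
qed

text \<open>The action is isometric, so moving the orbit point by \<open>R\<close> amounts to moving
  \<open>W\<close> by the inverse frame.\<close>

lemma frob_dist_frame:
  assumes R: "\<And>l. l \<le> L \<Longrightarrow> orthogonal_mat (d l) (R l)"
  shows "frob_dist d L (act d (\<lambda>l. tr (R l)) W) V = frob_dist d L W (act d R V)"
proof -
  have "frob_dist d L W (act d R V)
     = frob_dist d L (act d (\<lambda>l. tr (R l)) W) (act d (\<lambda>l. tr (R l)) (act d R V))"
    by (rule frob_dist_act[symmetric]) (simp add: R orthogonal_mat_tr)
  also have "\<dots> = frob_dist d L (act d (\<lambda>l. tr (R l)) W) V"
    by (rule frob_dist_cong) (auto intro: act_orth_inverse[OF R])
  finally show ?thesis by simp
qed

text \<open>Stationarity of the squared distance under a rotation of the plane \<open>(p, q)\<close>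
  in all layers of \<open>Z\<close> at once.\<close>
lemma rotation_stationary:
  assumes pq: "p \<noteq> q" and Z: "\<And>l. l \<in> Z \<Longrightarrow> l \<le> L \<and> p < d l \<and> q < d l"
    and bd: "\<And>l i. l \<le> L \<Longrightarrow> d l \<le> i \<Longrightarrow> b i = 0"
    and min: "\<And>\<theta>. frob_dist d L W (\<lambda>_. diagm b)
      \<le> frob_dist d L W (act d (\<lambda>l. if l \<in> Z then givens p q \<theta> else idm) (\<lambda>_. diagm b))"
  shows "(\<Sum>l=1..L. (if l \<in> Z then b p * W l q p - b q * W l p q else 0)
     + (if l - 1 \<in> Z then b p * W l p q - b q * W l q p else 0)) = 0"
proof -
  define G where "G \<theta> l = (if l \<in> Z then givens p q \<theta> else idm)" for \<theta> l
  define G' where "G' l = (if l \<in> Z then rot_gen p q else (\<lambda>_ _. 0))" for l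
  define D where "D = diagm b"
  define f where "f \<theta> = (\<Sum>(l, i, j)\<in>idx d L. (W l i j - act d (G \<theta>) (\<lambda>_. D) l i j)\<^sup>2)" for \<theta>
  have G0: "G 0 l = idm" for l using pq by (simp add: G_def givens_0)
  have act0: "act d (G 0) (\<lambda>_. D) l i j = D i j" if "i < d l" "j < d (l - 1)" for l i j
    using that by (simp add: act_def G0 mmul_idm_left mmul_idm_right)
  have DG: "((\<lambda>\<theta>. G \<theta> l i j) has_real_derivative G' l i j) (at 0)" for l i j
    by (simp add: G_def G'_def DERIV_givens)
  have Dact: "((\<lambda>\<theta>. act d (G \<theta>) (\<lambda>_. D) l i j) has_real_derivative
      G' l i j * b j + b i * G' (l - 1) j i) (at 0)" if l: "l \<in> {1..L}" "i < d l" "j < d (l - 1)" for l i j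
  proof -
    have "((\<lambda>\<theta>. act d (G \<theta>) (\<lambda>_. D) l i j) has_real_derivative
      (\<Sum>k<d l. G' l i k * (\<Sum>m<d (l - 1). D k m * G 0 (l - 1) j m)
         + (\<Sum>m<d (l - 1). D k m * G' (l - 1) j m) * G 0 l i k)) (at 0)"
      unfolding act_def mmul_def tr_def
      by (intro DERIV_sum DERIV_mult DG DERIV_cmult)
    also have "(\<Sum>k<d l. G' l i k * (\<Sum>m<d (l - 1). D k m * G 0 (l - 1) j m)
         + (\<Sum>m<d (l - 1). D k m * G' (l - 1) j m) * G 0 l i k)
      = mmul (G' l) (mmul D (tr idm) (d (l - 1))) (d l) i j + mmul idm (mmul D (tr (G' (l - 1))) (d (l - 1))) (d l) i j"
      by (simp add: mmul_def tr_def G0 sum.distrib mult.commute)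
    also have "mmul (G' l) (mmul D (tr idm) (d (l - 1))) (d l) i j = mmul (G' l) D (d l) i j"
      by (rule mmul_cong) (use l in \<open>auto simp: mmul_idm_right\<close>)
    also have "\<dots> = G' l i j * b j"
      using bd[of l j] l by (simp add: D_def mmul_diagm_right)
    also have "mmul idm (mmul D (tr (G' (l - 1))) (d (l - 1))) (d l) i j = b i * G' (l - 1) j i"
    proof -
      have "l - 1 \<le> L" using l by auto
      then have "d (l - 1) \<le> i \<Longrightarrow> b i = 0" by (rule bd)
      then show ?thesis using l by (auto simp: mmul_idm_left D_def mmul_diagm_left tr_def)
    qed
    finally show ?thesis .
  qed
  have "(f has_real_derivative
     (\<Sum>(l, i, j)\<in>idx d L. 2 * (W l i j - D i j) * - (G' l i j * b j + b i * G' (l - 1) j i))) (at 0)"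
    unfolding f_def split_def
  proof (intro DERIV_sum)
    fix x assume "x \<in> idx d L"
    then obtain l i j where x: "x = (l, i, j)" "l \<in> {1..L}" "i < d l" "j < d (l - 1)"
      by (auto simp: idx_def)
    show "((\<lambda>\<theta>. (W (fst x) (fst (snd x)) (snd (snd x))
        - act d (G \<theta>) (\<lambda>_. D) (fst x) (fst (snd x)) (snd (snd x)))\<^sup>2) has_real_derivative
      2 * (W (fst x) (fst (snd x)) (snd (snd x)) - D (fst (snd x)) (snd (snd x)))
       * - (G' (fst x) (fst (snd x)) (snd (snd x)) * b (snd (snd x))
         + b (fst (snd x)) * G' (fst x - 1) (snd (snd x)) (fst (snd x)))) (at 0)"
      using x(2-4) unfolding x(1) fst_conv snd_conv
      by (auto intro!: derivative_eq_intros Dact simp: act0)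
  qed
  moreover have "f 0 \<le> f \<theta>" for \<theta>
  proof -
    have "f 0 = (\<Sum>(l, i, j)\<in>idx d L. (W l i j - D i j)\<^sup>2)"
      unfolding f_def by (rule sum.cong) (auto simp: idx_def act0)
    moreover have "G \<theta> = (\<lambda>l. if l \<in> Z then givens p q \<theta> else idm)"
      by (simp add: G_def fun_eq_iff)
    then have "frob_dist d L W (\<lambda>_. D) \<le> frob_dist d L W (act d (G \<theta>) (\<lambda>_. D))"
      using min[of \<theta>] by (simp only: D_def)
    ultimately show ?thesis
      by (simp add: frob_dist_def f_def)
  qed
  ultimately have "(\<Sum>(l, i, j)\<in>idx d L. 2 * (W l i j - D i j) * - (G' l i j * b j + b i * G' (l - 1) j i)) = 0"
    using DERIV_local_min[of f _ 0 1] by simp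
  \<comment> \<open>\<open>D\<close> drops out: it vanishes off the diagonal, and the generator of a
    rotation vanishes on it.\<close>
  moreover have "2 * (W l i j - D i j) * - (G' l i j * b j + b i * G' (l - 1) j i)
     = - 2 * (W l i j * (G' l i j * b j) + W l i j * (b i * G' (l - 1) j i))" for l i j
    by (cases "i = j") (use pq in \<open>auto simp: D_def diagm_def G'_def rot_gen_def algebra_simps\<close>)
  ultimately have "(\<Sum>(l, i, j)\<in>idx d L. - 2 * (W l i j * (G' l i j * b j) + W l i j * (b i * G' (l - 1) j i))) = 0"
    by simp
  then have main: "(\<Sum>l=1..L. (\<Sum>i<d l. \<Sum>j<d (l - 1). W l i j * (G' l i j * b j))
      + (\<Sum>i<d l. \<Sum>j<d (l - 1). W l i j * (b i * G' (l - 1) j i))) = 0"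
    unfolding sum_idx sum_distrib_left[symmetric] sum.distrib by simp
  have pick: "(\<Sum>i<m. \<Sum>j<n. if i = a \<and> j = c then z i j else 0) = (if a < m \<and> c < n then z a c else 0)"
    for m n a c :: nat and z :: "nat \<Rightarrow> nat \<Rightarrow> real"
  proof -
    have "(\<Sum>i<m. \<Sum>j<n. if i = a \<and> j = c then z i j else 0)
       = (\<Sum>i<m. if i = a then (\<Sum>j<n. if j = c then z a j else 0) else 0)"
      by (intro sum.cong) auto
    then show ?thesis by simp
  qed
  have t1: "(\<Sum>i<d l. \<Sum>j<d (l - 1). W l i j * (G' l i j * b j))
     = (if l \<in> Z then b p * W l q p - b q * W l p q else 0)" if l: "l \<in> {1..L}" for l
  proof (cases "l \<in> Z")
    case True
    have "(\<Sum>i<d l. \<Sum>j<d (l - 1). W l i j * (G' l i j * b j))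
       = (\<Sum>i<d l. \<Sum>j<d (l - 1). (if i = q \<and> j = p then W l i j * b j else 0) - (if i = p \<and> j = q then W l i j * b j else 0))"
      by (intro sum.cong) (use True pq in \<open>auto simp: G'_def rot_gen_def\<close>)
    also have "\<dots> = (if q < d l \<and> p < d (l - 1) then W l q p * b p else 0)
        - (if p < d l \<and> q < d (l - 1) then W l p q * b q else 0)"
      unfolding sum_subtractf pick ..
    \<comment> \<open>\<open>l \<in> Z\<close> bounds \<open>p\<close> and \<open>q\<close> by
      \<open>d l\<close> only. If one of them exceeds \<open>d (l - 1)\<close>, the coefficient
      \<open>b\<close> there is zero.\<close>
    also have "\<dots> = W l q p * b p - W l p q * b q"
      using Z[OF True] bd[of "l - 1"] l by (auto simp: not_less)
    finally show ?thesis using True by (simp add: mult.commute)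
  qed (simp add: G'_def)
  have t2: "(\<Sum>i<d l. \<Sum>j<d (l - 1). W l i j * (b i * G' (l - 1) j i))
     = (if l - 1 \<in> Z then b p * W l p q - b q * W l q p else 0)" if l: "l \<in> {1..L}" for l
  proof (cases "l - 1 \<in> Z")
    case True
    have "(\<Sum>i<d l. \<Sum>j<d (l - 1). W l i j * (b i * G' (l - 1) j i))
       = (\<Sum>i<d l. \<Sum>j<d (l - 1). (if i = p \<and> j = q then W l i j * b i else 0) - (if i = q \<and> j = p then W l i j * b i else 0))"
      by (intro sum.cong) (use True pq in \<open>auto simp: G'_def rot_gen_def\<close>)
    also have "\<dots> = (if p < d l \<and> q < d (l - 1) then W l p q * b p else 0)
        - (if q < d l \<and> p < d (l - 1) then W l q p * b q else 0)"
      unfolding sum_subtractf pick ..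
    also have "\<dots> = W l p q * b p - W l q p * b q"
      using Z[OF True] bd[of l] l by (auto simp: not_less)
    finally show ?thesis using True by (simp add: mult.commute)
  qed (simp add: G'_def)
  show ?thesis
    by (rule trans[OF _ main], intro sum.cong refl) (simp only: t1 t2)
qed

section \<open>The critical set as a union of orbits\<close>

text \<open>Since \<open>y\<close> is sorted, the indices of its positive entries form an initial
  segment, so their number also works as a threshold.\<close>

lemma rY_iff:
  assumes "\<And>i. i < dmin d L \<Longrightarrow> y i \<ge> 0" "\<And>i j. i \<le> j \<Longrightarrow> j < dmin d L \<Longrightarrow> y j \<le> y i"
  shows "i < rY d L y \<longleftrightarrow> i < dmin d L \<and> y i > 0"
proof -
  let ?S = "{i. i < dmin d L \<and> y i > 0}"
  have fin: "finite ?S" by simp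
  have down: "j \<in> ?S" if "i \<in> ?S" "j \<le> i" for i j
    using assms(2)[of j i] that by auto
  have "?S = {..<rY d L y}"
  proof (rule card_subset_eq[symmetric])
    show "finite ?S" by (rule fin)
    show "card {..<rY d L y} = card ?S" by (simp add: rY_def)
    show "{..<rY d L y} \<subseteq> ?S"
    proof (rule ccontr)
      assume "\<not> ?thesis"
      then obtain i where i: "i < rY d L y" "i \<notin> ?S" by auto
      then have "?S \<subseteq> {..<i}" using down[of _ i] by (meson lessThan_iff linorder_not_less subsetI)
      then have "card ?S \<le> card {..<i}" by (intro card_mono) auto
      then show False using i by (simp add: rY_def)
    qed
  qed
  then show ?thesis by (metis (mono_tags, lifting) lessThan_iff mem_Collect_eq)
qed

lemma rY_le: "rY d L y \<le> dmin d L"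
proof -
  have "card {i. i < dmin d L \<and> y i > 0} \<le> card {..<dmin d L}" by (intro card_mono) auto
  then show ?thesis by (simp add: rY_def)
qed

text \<open>On a block \<open>y\<close> is constant and can be pulled out of the sum; there
  \<open>R L\<close> and \<open>R 0\<close> agree, so orthogonality of \<open>R 0\<close> finishes,
  and beyond \<open>rY\<close> the matrix is zero. The double transpose matches the form that
  \<open>gradG_norm_act\<close> asks of the inverse frame \<open>tr (R l)\<close>.\<close>

lemma frame_fixes_Y:
  assumes R: "R \<in> frames d L y (rY d L y)"
    and pos: "\<And>i. i < dmin d L \<Longrightarrow> rY d L y \<le> i \<Longrightarrow> y i = 0"
    and ij: "i < d L" "j < d 0"
  shows "mmul (tr (R L)) (mmul (Ymat d L y) (tr (tr (R 0))) (d 0)) (d L) i j = Ymat d L y i j"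
proof -
  define r where "r = rY d L y"
  define c where "c k = (if k < r then y k else 0)" for k
  have r: "r \<le> d 0" "r \<le> d L" using rY_le[of d L y] by (auto simp: r_def dmin_def)
  have Y: "Ymat d L y = diagm c"
    using pos rY_le[of d L y] by (auto simp: Ymat_def diagm_def c_def r_def fun_eq_iff)
  have bd: "blockdiag_orth y r (d 0) (R 0)" "blockdiag_orth y r (d L) (R L)"
    and eq: "\<And>i j. i < r \<Longrightarrow> j < r \<Longrightarrow> R L i j = R 0 i j"
    using R by (auto simp: frames_def r_def)
  have z0: "R 0 k i = 0" if "k < d 0" "i < d 0" "\<not> same_block y r k i" for k i
    using bd that by (auto simp: blockdiag_orth_def)
  have zL: "R L k i = 0" if "k < d L" "i < d L" "\<not> same_block y r k i" for k i
    using bd that by (auto simp: blockdiag_orth_def)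
  have "mmul (tr (R L)) (mmul (diagm c) (R 0) (d 0)) (d L) i j
     = (\<Sum>k<d L. R L k i * (if k < d 0 then c k * R 0 k j else 0))"
    unfolding mmul_def[of "tr (R L)"] mmul_diagm_left tr_apply ..
  also have "\<dots> = (\<Sum>k<r. c i * (R L k i * R 0 k j))"
  proof (rule sum.mono_neutral_cong_right)
    show "finite {..<d L}" "{..<r} \<subseteq> {..<d L}" using r by auto
    show "\<forall>k\<in>{..<d L} - {..<r}. R L k i * (if k < d 0 then c k * R 0 k j else 0) = 0"
      by (auto simp: c_def)
    fix k assume k: "k \<in> {..<r}"
    show "R L k i * (if k < d 0 then c k * R 0 k j else 0) = c i * (R L k i * R 0 k j)"
    proof (cases "same_block y r k i")
      case True
      then have "c k = c i" using k by (auto simp: same_block_def c_def)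
      then show ?thesis using k r by auto
    next
      case False
      then show ?thesis using zL[of k i] k r ij by simp
    qed
  qed
  also have "\<dots> = diagm c i j"
  proof (cases "i < r")
    case False
    then show ?thesis by (simp add: c_def diagm_def)
  next
    case i: True
    have "(\<Sum>k<r. c i * (R L k i * R 0 k j)) = c i * (\<Sum>k<r. R 0 k i * R 0 k j)"
      by (simp add: sum_distrib_left eq i)
    also have "(\<Sum>k<r. R 0 k i * R 0 k j) = (\<Sum>k<d 0. R 0 k i * R 0 k j)"
    proof (rule sum.mono_neutral_left)
      show "\<forall>k\<in>{..<d 0} - {..<r}. R 0 k i * R 0 k j = 0"
      proof
        fix k assume "k \<in> {..<d 0} - {..<r}"
        then have "R 0 k i = 0" using z0[of k i] i r by (auto simp: same_block_def)
        then show "R 0 k i * R 0 k j = 0" by simp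
      qed
    qed (use r in auto)
    also have "\<dots> = (if i = j then 1 else 0)"
      using bd(1) i r ij by (auto simp: blockdiag_orth_def orthogonal_mat_def)
    finally show ?thesis by (simp add: diagm_def)
  qed
  finally show ?thesis by (simp add: Y)
qed

text \<open>\<open>R G\<close> is a frame for every frame \<open>G\<close>, so optimality of
  \<open>R\<close> says that no \<open>G\<close> brings \<open>diag(b)\<close> closer to the tuple
  moved back by \<open>R\<close>. Stationarity under rotations with \<open>Z = {l}\<close> and
  \<open>Z = {0, L}\<close> gives the two families of slice conditions.\<close>

lemma nearest_in_slice:
  assumes L2: "L \<ge> 2" and R: "R \<in> frames d L y (rY d L y)"
    and min: "\<And>R'. R' \<in> frames d L y (rY d L y) \<Longrightarrow>
      frob_dist d L W (act d R (\<lambda>_. diagm b)) \<le> frob_dist d L W (act d R' (\<lambda>_. diagm b))"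
    and width: "\<And>l. l \<le> L \<Longrightarrow> dmin d L \<le> d l" and bN: "\<And>i. dmin d L \<le> i \<Longrightarrow> b i = 0"
    and rY: "\<And>i. i < dmin d L \<Longrightarrow> y i > 0 \<Longrightarrow> i < rY d L y"
  shows "in_slice d L y b (act d (\<lambda>l. tr (R l)) W)"
proof -
  define V where "V = act d (\<lambda>l. tr (R l)) W"
  have r: "rY d L y \<le> d 0" "rY d L y \<le> d L"
    using rY_le[of d L y] by (auto simp: dmin_def)
  have bd: "b i = 0" if "l \<le> L" "d l \<le> i" for l i
    using bN width that le_trans by blast
  have V: "frob_dist d L V U = frob_dist d L W (act d R U)" for U
    unfolding V_def by (rule frob_dist_frame[OF frames_orth[OF R]])
  have minV: "frob_dist d L V (\<lambda>_. diagm b) \<le> frob_dist d L V (act d G (\<lambda>_. diagm b))"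
    if "G \<in> frames d L y (rY d L y)" for G
    using min[OF frames_mmul[OF R that r]] by (simp add: V act_act)
  have stat: "(\<Sum>l=1..L. (if l \<in> Z then b p * V l q p - b q * V l p q else 0)
     + (if l - 1 \<in> Z then b p * V l p q - b q * V l q p else 0)) = 0"
    if "p \<noteq> q" "\<And>l. l \<in> Z \<Longrightarrow> l \<le> L \<and> p < d l \<and> q < d l"
      "(0 \<notin> Z \<and> L \<notin> Z) \<or> (0 \<in> Z \<and> L \<in> Z \<and> same_block y (rY d L y) p q)" for p q Z
    using that by (intro rotation_stationary[OF that(1,2) bd] minV rotation_in_frames) auto
  have "b j * V l i j - b i * V l j i + b j * V (Suc l) j i - b i * V (Suc l) i j = 0"
    if l: "1 \<le> l" "l < L" "i < d l" "j < d l" "i \<noteq> j" for l i j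
  proof -
    have "(\<Sum>m=1..L. (if m \<in> {l} then b i * V m j i - b j * V m i j else 0)
       + (if m - 1 \<in> {l} then b i * V m i j - b j * V m j i else 0)) = 0"
      by (rule stat) (use l in auto)
    moreover have "(\<Sum>m=1..L. (if m \<in> {l} then b i * V m j i - b j * V m i j else 0)
       + (if m - 1 \<in> {l} then b i * V m i j - b j * V m j i else 0))
      = (\<Sum>m=1..L. (if m = l then b i * V l j i - b j * V l i j else 0)
       + (if m = Suc l then b i * V (Suc l) i j - b j * V (Suc l) j i else 0))"
      by (rule sum.cong) auto
    ultimately show ?thesis using l by (simp add: sum.distrib)
  qed
  moreover have "b i * V 1 i j - b j * V 1 j i + b i * V L j i - b j * V L i j = 0"
    if l: "i < dmin d L" "j < dmin d L" "i \<noteq> j" "y i = y j" "y i > 0" for i j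
  proof -
    have "(\<Sum>m=1..L. (if m \<in> {0, L} then b i * V m j i - b j * V m i j else 0)
       + (if m - 1 \<in> {0, L} then b i * V m i j - b j * V m j i else 0)) = 0"
    proof (rule stat[OF l(3)])
      show "m \<in> {0, L} \<Longrightarrow> m \<le> L \<and> i < d m \<and> j < d m" for m
        using width[of m] l by auto
      have "same_block y (rY d L y) i j" using rY[of i] rY[of j] l by (auto simp: same_block_def)
      then show "(0 \<notin> {0, L} \<and> L \<notin> {0, L}) \<or> (0 \<in> {0, L} \<and> L \<in> {0, L} \<and> same_block y (rY d L y) i j)"
        by simp
    qed
    moreover have "(\<Sum>m=1..L. (if m \<in> {0, L} then b i * V m j i - b j * V m i j else 0)
       + (if m - 1 \<in> {0, L} then b i * V m i j - b j * V m j i else 0))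
      = (\<Sum>m=1..L. (if m = L then b i * V L j i - b j * V L i j else 0)
       + (if m = 1 then b i * V 1 i j - b j * V 1 j i else 0))"
      by (rule sum.cong) (use L2 in auto)
    ultimately show ?thesis using L2 by (simp add: sum.distrib)
  qed
  ultimately show ?thesis
    unfolding in_slice_def V_def[symmetric] by blast
qed

text \<open>Moves the permutation across the diagonal, turning \<open>s\<close> into
  \<open>s o p\<close>. \<open>Sigma\<close> is rectangular, so the permutation matrices on its two
  sides have different sizes.\<close>

lemma blk_perm_intertwine:
  assumes p: "p permutes {..<N}" and mn: "N \<le> m" "N \<le> n" and ij: "i < m" "j < n"
  shows "mmul (Sigma_mat N s) (blk_perm n N p) n i j
    = mmul (blk_perm m N p) (diagm (\<lambda>i. if i < N then s (p i) else 0)) m i j"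
proof -
  have pN: "p j < N \<longleftrightarrow> j < N" for j using permutes_in_image[OF p, of j] by simp
  have "Sigma_mat N s = diagm (\<lambda>i. if i < N then s i else 0)"
    by (auto simp: Sigma_mat_def diagm_def fun_eq_iff)
  then show ?thesis
    using mn ij pN[of j]
    by (auto simp: mmul_diagm_left mmul_diagm_right blk_perm_def perm_mat_def)
qed

lemma orthogonal_mat_blk_perm:
  assumes p: "p permutes {..<N}" and "N \<le> m"
  shows "orthogonal_mat m (blk_perm m N p)"
proof -
  define f where "f j = (if j < N then p j else j)" for j
  have pN: "p j < N \<longleftrightarrow> j < N" for j using permutes_in_image[OF p, of j] by simp
  have inj: "f i = f j \<longleftrightarrow> i = j" for i j
    using pN[of i] pN[of j] inj_eq[OF permutes_inj[OF p], of i j]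
    by (cases "i < N"; cases "j < N") (auto simp: f_def)
  have fm: "f j < m" if "j < m" for j using pN[of j] assms(2) that by (auto simp: f_def)
  have P: "blk_perm m N p k j = (if k = f j then 1 else 0)" if "k < m" "j < m" for k j
    using that pN[of j] assms(2) by (cases "j < N") (simp_all add: blk_perm_def perm_mat_def f_def)
  show ?thesis
    unfolding orthogonal_mat_def
  proof (intro allI impI)
    fix i j assume ij: "i < m" "j < m"
    have "(\<Sum>k<m. blk_perm m N p k i * blk_perm m N p k j) = (\<Sum>k<m. if k = f i then (if i = j then 1 else 0) else 0)"
    proof (rule sum.cong)
      fix k assume "k \<in> {..<m}"
      then show "blk_perm m N p k i * blk_perm m N p k j = (if k = f i then if i = j then 1 else 0 else 0)"
        using P[of k i] P[of k j] ij inj[of i j] by (cases "k = f i") simp_all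
    qed simp
    then show "(\<Sum>k<m. blk_perm m N p k i * blk_perm m N p k j) = (if i = j then 1 else 0)"
      using fm ij by simp
  qed
qed

text \<open>With \<open>R\<^sub>l = Q\<^sub>l\<^sub>+\<^sub>1 \<Pi>\<close> the permutation is absorbed into the hidden frames, and an element of
  \<open>\<W>\<close> becomes \<open>W\<^sub>l = R\<^sub>l diag(a) R\<^sub>l\<^sub>-\<^sub>1\<^sup>T\<close> with \<open>a = s \<circ> p\<close>.\<close>
lemma act_eq_Wset_form:
  fixes s p N
  defines "b \<equiv> (\<lambda>i. if i < N then s (p i) else 0)"
  assumes L2: "L \<ge> 2" and p: "p permutes {..<N}" and dN: "\<And>l. l \<le> L \<Longrightarrow> N \<le> d l"
    and R0: "R 0 = tr V" and RL: "R L = U"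
    and RQ: "\<And>l i j. 1 \<le> l \<Longrightarrow> l < L \<Longrightarrow> i < d l \<Longrightarrow> j < d l \<Longrightarrow>
      R l i j = mmul (Q (l + 1)) (blk_perm (d l) N p) (d l) i j"
  shows "i < d 1 \<Longrightarrow> j < d 0 \<Longrightarrow> act d R (\<lambda>_. diagm b) 1 i j =
      mmul (mmul (mmul (Q 2) (Sigma_mat N s) (d 1)) (blk_perm (d 0) N p) (d 0)) V (d 0) i j"
    and "2 \<le> l \<Longrightarrow> l < L \<Longrightarrow> i < d l \<Longrightarrow> j < d (l - 1) \<Longrightarrow> act d R (\<lambda>_. diagm b) l i j =
      mmul (mmul (Q (l + 1)) (Sigma_mat N s) (d l)) (tr (Q l)) (d (l - 1)) i j"
    and "i < d L \<Longrightarrow> j < d (L - 1) \<Longrightarrow> act d R (\<lambda>_. diagm b) L i j =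
      mmul (mmul (mmul U (tr (blk_perm (d L) N p)) (d L)) (Sigma_mat N s) (d L)) (tr (Q L)) (d (L - 1)) i j"
proof -
  let ?D = "diagm b" and ?S = "Sigma_mat N s"
  define P where "P m = blk_perm m N p" for m
  have RQ: "R l i j = mmul (Q (l + 1)) (P (d l)) (d l) i j" if "1 \<le> l" "l < L" "i < d l" "j < d l" for l i j
    using RQ[OF that] by (simp add: P_def)
  have tw: "mmul (P m) ?D m i j = mmul ?S (P n) n i j" if "N \<le> m" "N \<le> n" "i < m" "j < n" for m n i j
    unfolding b_def P_def by (rule blk_perm_intertwine[OF p that, symmetric])
  have trS: "tr ?S = ?S" by (auto simp: Sigma_mat_def tr_def fun_eq_iff)
  have tw': "mmul ?D (tr (P m)) m j i = mmul (tr (P n)) ?S n j i" if "N \<le> m" "N \<le> n" "i < m" "j < n" for m n i j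
  proof -
    have "tr (mmul (P m) ?D m) j i = tr (mmul ?S (P n) n) j i"
      using tw[OF that] by (simp add: tr_def)
    then show ?thesis by (simp add: tr_mmul trS)
  qed
  have orthP: "orthogonal_mat (d l) (P (d l))" if "l \<le> L" for l
    unfolding P_def by (rule orthogonal_mat_blk_perm[OF p dN[OF that]])
  show "act d R (\<lambda>_. ?D) 1 i j = mmul (mmul (mmul (Q 2) ?S (d 1)) (blk_perm (d 0) N p) (d 0)) V (d 0) i j"
    if "i < d 1" "j < d 0"
  proof -
    have "act d R (\<lambda>_. ?D) 1 i j = mmul (R 1) (mmul ?D V (d 0)) (d 1) i j"
      by (simp add: act_def R0)
    also have "\<dots> = mmul (mmul (Q 2) (P (d 1)) (d 1)) (mmul ?D V (d 0)) (d 1) i j"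
      by (rule mmul_cong) (use RQ[of 1 i] that L2 in \<open>auto simp: numeral_2_eq_2\<close>)
    also have "\<dots> = mmul (Q 2) (mmul (mmul (P (d 1)) ?D (d 1)) V (d 0)) (d 1) i j"
      by (simp add: mmul_assoc)
    also have "\<dots> = mmul (Q 2) (mmul (mmul ?S (P (d 0)) (d 0)) V (d 0)) (d 1) i j"
      by (intro mmul_cong refl tw dN) (use L2 in auto)
    finally show ?thesis by (simp add: mmul_assoc P_def)
  qed
  show "act d R (\<lambda>_. ?D) l i j = mmul (mmul (Q (l + 1)) ?S (d l)) (tr (Q l)) (d (l - 1)) i j"
    if l: "2 \<le> l" "l < L" "i < d l" "j < d (l - 1)"
  proof -
    have l1: "l - 1 + 1 = l" "l - 1 \<le> L" using l by auto
    have "act d R (\<lambda>_. ?D) l i j = mmul (mmul (Q (l + 1)) (P (d l)) (d l))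
        (mmul ?D (tr (mmul (Q l) (P (d (l - 1))) (d (l - 1)))) (d (l - 1))) (d l) i j"
      unfolding act_def
      by (rule mmul_cong3) (use RQ[of l i] RQ[of "l - 1" j] l l1 in \<open>auto simp: tr_apply\<close>)
    also have "\<dots> = mmul (Q (l + 1)) (mmul (mmul (P (d l)) ?D (d l)) (mmul (tr (P (d (l - 1)))) (tr (Q l)) (d (l - 1))) (d (l - 1))) (d l) i j"
      by (simp add: mmul_assoc tr_mmul)
    also have "\<dots> = mmul (Q (l + 1)) (mmul (mmul ?S (P (d (l - 1))) (d (l - 1))) (mmul (tr (P (d (l - 1)))) (tr (Q l)) (d (l - 1))) (d (l - 1))) (d l) i j"
      by (intro mmul_cong refl tw dN) (use l in auto)
    also have "\<dots> = mmul (mmul (Q (l + 1)) ?S (d l)) (tr (Q l)) (d (l - 1)) i j"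
      using orthP[OF l1(2)] by (simp add: mmul_assoc mmul_orth_cancel)
    finally show ?thesis .
  qed
  show "act d R (\<lambda>_. ?D) L i j
     = mmul (mmul (mmul U (tr (blk_perm (d L) N p)) (d L)) ?S (d L)) (tr (Q L)) (d (L - 1)) i j"
    if l: "i < d L" "j < d (L - 1)"
  proof -
    have l1: "L - 1 + 1 = L" "L - 1 \<le> L" "1 \<le> L - 1" "L - 1 < L" using L2 by auto
    have "act d R (\<lambda>_. ?D) L i j
        = mmul U (mmul ?D (tr (mmul (Q L) (P (d (L - 1))) (d (L - 1)))) (d (L - 1))) (d L) i j"
      unfolding act_def RL
      by (rule mmul_cong3) (use RQ[of "L - 1" j] l l1 in \<open>auto simp: tr_apply\<close>)
    also have "\<dots> = mmul U (mmul (mmul ?D (tr (P (d (L - 1)))) (d (L - 1))) (tr (Q L)) (d (L - 1))) (d L) i j"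
      by (simp add: mmul_assoc tr_mmul)
    also have "\<dots> = mmul U (mmul (mmul (tr (P (d L))) ?S (d L)) (tr (Q L)) (d (L - 1))) (d L) i j"
      by (intro mmul_cong refl tw' dN) (use l1 in auto)
    finally show ?thesis by (simp add: mmul_assoc P_def)
  qed
qed

lemma blockdiag_orth_tr: "blockdiag_orth y r m M \<Longrightarrow> blockdiag_orth y r m (tr M)"
  using same_block_sym by (fastforce simp: blockdiag_orth_def orthogonal_mat_tr tr_apply)

text \<open>Undoes the substitution of \<open>act_eq_Wset_form\<close>:
  \<open>Q_l = R_{l-1} \<Pi>^T\<close>, with \<open>\<Pi>\<close> orthogonal. The shift of the index
  arises because \<open>Q_l\<close> acts on the layer space of dimension
  \<open>d (l - 1)\<close>.\<close>

lemma act_in_Wset: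
  assumes L2: "L \<ge> 2" and width: "\<And>l. l \<le> L \<Longrightarrow> dmin d L \<le> d l"
    and p: "p permutes {..<dmin d L}" "(\<lambda>i. s (p i)) \<in> Aset d L lam y"
    and R: "R \<in> frames d L y (rY d L y)"
  shows "act d R (\<lambda>_. diagm (\<lambda>i. if i < dmin d L then s (p i) else 0)) \<in> Wset d L lam y s"
proof -
  define P where "P m = blk_perm m (dmin d L) p" for m
  define Q where "Q l = mmul (R (l - 1)) (tr (P (d (l - 1)))) (d (l - 1))" for l
  have orthP: "orthogonal_mat (d l) (P (d l))" if "l \<le> L" for l
    unfolding P_def by (rule orthogonal_mat_blk_perm[OF p(1) width[OF that]])
  have RQ: "R l i j = mmul (Q (l + 1)) (blk_perm (d l) (dmin d L) p) (d l) i j"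
    if l: "1 \<le> l" "l < L" "i < d l" "j < d l" for l i j
  proof -
    have "mmul (Q (l + 1)) (P (d l)) (d l) i j = mmul (R l) (mmul (tr (P (d l))) (P (d l)) (d l)) (d l) i j"
      by (simp add: Q_def mmul_assoc)
    also have "\<dots> = mmul (R l) idm (d l) i j"
      by (rule mmul_cong) (use l orthP[of l] in \<open>auto simp: mmul_orth_id\<close>)
    finally show ?thesis using l by (simp add: mmul_idm_right P_def)
  qed
  note form = act_eq_Wset_form[where R = R and V = "tr (R 0)" and U = "R L" and Q = Q
      and s = s, OF L2 p(1) width tr_tr[symmetric] refl RQ]
  have Q: "\<forall>l\<in>{2..L}. orthogonal_mat (d (l - 1)) (Q l)"
  proof
    fix l assume "l \<in> {2..L}"
    then have "l - 1 \<le> L" by auto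
    then show "orthogonal_mat (d (l - 1)) (Q l)"
      unfolding Q_def using frames_orth[OF R] orthP by (intro orthogonal_mat_mmul orthogonal_mat_tr)
  qed
  show ?thesis
    unfolding Wset_def
    by (intro CollectI exI[of _ p] exI[of _ Q] exI[of _ "R L"] exI[of _ "tr (R 0)"] conjI ballI allI impI p
        form Q[rule_format])
      (use R L2 in \<open>auto simp: frames_def blockdiag_orth_tr tr_apply\<close>)
qed

text \<open>The converse of \<open>act_in_Wset\<close>, with equality only in range because
  \<open>Wset\<close> leaves all other entries free. Distances do not see these.\<close>

lemma Wset_cases:
  assumes L2: "L \<ge> 2" and width: "\<And>l. l \<le> L \<Longrightarrow> dmin d L \<le> d l"
    and W: "W \<in> Wset d L lam y s"
  obtains p R where "p permutes {..<dmin d L}" "(\<lambda>i. s (p i)) \<in> Aset d L lam y"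
    "R \<in> frames d L y (rY d L y)"
    "\<And>l i j. 1 \<le> l \<Longrightarrow> l \<le> L \<Longrightarrow> i < d l \<Longrightarrow> j < d (l - 1) \<Longrightarrow>
      W l i j = act d R (\<lambda>_. diagm (\<lambda>i. if i < dmin d L then s (p i) else 0)) l i j"
proof -
  obtain p Q U V where p: "p permutes {..<dmin d L}" "(\<lambda>i. s (p i)) \<in> Aset d L lam y"
    and Q: "\<forall>l\<in>{2..L}. orthogonal_mat (d (l - 1)) (Q l)"
    and V: "blockdiag_orth y (rY d L y) (d 0) V" and U: "blockdiag_orth y (rY d L y) (d L) U"
    and UV: "\<forall>i<rY d L y. \<forall>j<rY d L y. U i j = V j i"
    and W1: "\<forall>i<d 1. \<forall>j<d 0. W 1 i j =
          mmul (mmul (mmul (Q 2) (Sigma_mat (dmin d L) s) (d 1))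
                     (blk_perm (d 0) (dmin d L) p) (d 0)) V (d 0) i j"
    and Wl: "\<forall>l\<in>{2..L-1}. \<forall>i<d l. \<forall>j<d (l - 1). W l i j =
          mmul (mmul (Q (l + 1)) (Sigma_mat (dmin d L) s) (d l)) (tr (Q l)) (d (l - 1)) i j"
    and WL: "\<forall>i<d L. \<forall>j<d (L - 1). W L i j =
          mmul (mmul (mmul U (tr (blk_perm (d L) (dmin d L) p)) (d L))
                     (Sigma_mat (dmin d L) s) (d L)) (tr (Q L)) (d (L - 1)) i j"
    using W unfolding Wset_def mem_Collect_eq by (elim exE conjE) (rule that)
  define R where "R l = (if l = 0 then tr V else if l = L then U
    else mmul (Q (l + 1)) (blk_perm (d l) (dmin d L) p) (d l))" for l
  have R0: "R 0 = tr V" and RL: "R L = U" using L2 by (auto simp: R_def)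
  have Rl: "R l i j = mmul (Q (l + 1)) (blk_perm (d l) (dmin d L) p) (d l) i j"
    if "1 \<le> l" "l < L" "i < d l" "j < d l" for l i j using that by (simp add: R_def)
  note form = act_eq_Wset_form[where s = s, OF L2 p(1) width R0 RL Rl]
  have "orthogonal_mat (d l) (R l)" if l: "l \<le> L" for l
  proof -
    consider "l = 0" | "l = L" | "1 \<le> l" "l < L" using l by linarith
    then show ?thesis
    proof cases
      case 1
      then show ?thesis using V by (simp add: R0 blockdiag_orth_def orthogonal_mat_tr)
    next
      case 2
      then show ?thesis using U by (simp add: RL blockdiag_orth_def)
    next
      case 3
      then show ?thesis
        using Q[rule_format, of "l + 1"] orthogonal_mat_blk_perm[OF p(1) width[OF l]]
        by (simp add: R_def orthogonal_mat_mmul)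
    qed
  qed
  then have "R \<in> frames d L y (rY d L y)"
    using U blockdiag_orth_tr[OF V] UV by (auto simp: frames_def R0 RL tr_apply)
  moreover have "W l i j = act d R (\<lambda>_. diagm (\<lambda>i. if i < dmin d L then s (p i) else 0)) l i j"
    if l: "1 \<le> l" "l \<le> L" "i < d l" "j < d (l - 1)" for l i j
  proof -
    consider "l = 1" | "l = L" | "2 \<le> l" "l < L" using l by linarith
    then show ?thesis
    proof cases
      case 1
      then show ?thesis using W1 form(1) l by simp
    next
      case 2
      then show ?thesis using WL form(3) l by simp
    next
      case 3
      then show ?thesis using Wl form(2) l by simp
    qed
  qed
  ultimately show ?thesis using that p by blast
qed

text \<open>Elimination of \<open>b\<close>. With \<open>e = 1 / (2(L-1))\<close> and
  \<open>q = (L-2)/L\<close>, the double root condition says \<open>b = lam^e * q^e\<close>.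
  Inserted into \<open>crit\<close>, with \<open>sqrt lam = (lam^e)^(L-1)\<close>, it gives
  \<open>y = lam^e * C\<close> for the bracket \<open>C\<close> of the statement; then take the
  power \<open>2(L-1)\<close>.\<close>

lemma double_root_lam:
  fixes b y lam :: real
  assumes L3: "L \<ge> 3" and lam: "lam > 0" and b: "b > 0"
    and crit: "b ^ (2 * L - 1) - sqrt lam * y * b ^ (L - 1) + lam * b = 0"
    and double: "real L * b ^ (2 * L - 2) = lam * (real L - 2)"
  shows "lam = y ^ (2 * (L - 1)) /
      ((real (L - 2) / real L) powr (real L / (2 * (real L - 1)))
       + (real L / real (L - 2)) powr ((real L - 2) / (2 * (real L - 1)))) ^ (2 * (L - 1))"
proof -
  obtain M where M: "L = M + 2" and M1: "M \<ge> 1" using L3 by (intro that[of "L - 2"]) auto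
  define e q where "e = 1 / (2 * (real M + 1))" and "q = real M / (real M + 2)"
  have q: "q > 0" using M1 by (simp add: q_def)
  define \<kappa> h where "\<kappa> = lam powr e" and "h = q powr e"
  have \<kappa>: "\<kappa> > 0" and h: "h > 0" using lam q by (auto simp: \<kappa>_def h_def)
  have root: "(x powr e) ^ (2 * M + 2) = x" if "x > 0" for x :: real
  proof -
    have "(x powr e) ^ (2 * M + 2) = x powr (e * real (2 * M + 2))"
      using that by (simp add: powr_realpow[symmetric] powr_powr del: power_Suc)
    also have "e * real (2 * M + 2) = 1" by (simp add: e_def field_simps)
    finally show ?thesis using that by simp
  qed
  have h1: "q powr (real L / (2 * (real L - 1))) = h ^ (M + 2)"
  proof -
    have "h ^ (M + 2) = q powr (e * real (M + 2))"
      using q unfolding h_def by (subst powr_realpow[symmetric]) (simp_all add: powr_powr)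
    then show ?thesis by (simp add: e_def M add.commute)
  qed
  have h2: "(1 / q) powr ((real L - 2) / (2 * (real L - 1))) = 1 / h ^ M"
  proof -
    have "h ^ M = q powr (e * real M)"
      using q unfolding h_def by (subst powr_realpow[symmetric]) (simp_all add: powr_powr)
    then show ?thesis using q by (simp add: e_def M powr_divide add.commute)
  qed
  define C where "C = (real (L - 2) / real L) powr (real L / (2 * (real L - 1)))
       + (real L / real (L - 2)) powr ((real L - 2) / (2 * (real L - 1)))"
  have "real (L - 2) / real L = q" "real L / real (L - 2) = 1 / q"
    by (auto simp: M q_def add.commute)
  then have C: "C = h ^ (M + 2) + 1 / h ^ M"
    unfolding C_def by (simp only: h1 h2)
  have \<kappa>lam: "\<kappa> ^ (2 * M + 2) = lam" unfolding \<kappa>_def using lam by (rule root)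
  have hq: "h ^ (2 * M + 2) = q" unfolding h_def using q by (rule root)
  have "b ^ (2 * M + 2) = lam * q"
    using double by (simp add: M q_def field_simps)
  then have "b ^ (2 * M + 2) = (\<kappa> * h) ^ (2 * M + 2)"
    unfolding power_mult_distrib \<kappa>lam hq .
  then have bh: "b = \<kappa> * h"
    using b \<kappa> h by (intro power_eq_imp_eq_base[of b "2 * M + 2"]) auto
  have "(\<kappa> ^ (M + 1))\<^sup>2 = lam"
    unfolding power_mult[symmetric] \<kappa>lam[symmetric] by (simp add: mult.commute)
  then have slam: "sqrt lam = \<kappa> ^ (M + 1)"
    using \<kappa> by (intro real_sqrt_unique) auto
  have e3: "2 * L - 1 = 2 * M + 3" "L - 1 = M + 1" by (auto simp: M)
  have "b * (b ^ (2 * M + 2) - sqrt lam * y * b ^ M + lam) = 0"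
    using crit unfolding e3 by (simp add: algebra_simps numeral_3_eq_3)
  then have "b ^ (2 * M + 2) + lam = sqrt lam * y * b ^ M" using b by simp
  then have "\<kappa> ^ (2 * M + 2) * (h ^ (2 * M + 2) + 1) = \<kappa> ^ (M + 1) * y * (\<kappa> ^ M * h ^ M)"
    unfolding slam bh power_mult_distrib \<kappa>lam by (simp add: algebra_simps)
  also have "\<dots> = \<kappa> ^ (2 * M + 1) * (y * h ^ M)"
  proof -
    have "\<kappa> ^ (2 * M + 1) = \<kappa> ^ (M + 1) * \<kappa> ^ M"
      unfolding power_add[symmetric] by (simp add: mult_2)
    then show ?thesis by (simp only: mult_ac)
  qed
  also have "\<kappa> ^ (2 * M + 2) * (h ^ (2 * M + 2) + 1) = \<kappa> ^ (2 * M + 1) * (\<kappa> * (h ^ (2 * M + 2) + 1))"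
    by simp
  finally have "\<kappa> * (h ^ (2 * M + 2) + 1) = y * h ^ M" using \<kappa> by simp
  then have "y = \<kappa> * (h ^ (2 * M + 2) + 1) / h ^ M" using h by (simp add: field_simps)
  also have "\<dots> = \<kappa> * C"
  proof -
    have "h ^ (2 * M + 2) = h ^ (M + 2) * h ^ M"
      unfolding power_add[symmetric] by (simp add: mult_2)
    then show ?thesis
      using h unfolding C by (simp only: add_divide_distrib distrib_left) simp
  qed
  finally have "y ^ (2 * M + 2) = lam * C ^ (2 * M + 2)" by (simp only: power_mult_distrib \<kappa>lam)
  moreover have "C > 0" using h by (simp add: C add_pos_pos)
  moreover have "2 * (L - 1) = 2 * M + 2" by (simp add: M)
  ultimately show ?thesis unfolding C_def[symmetric] by simp
qed

lemma set_dist_eq_minimum: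
  assumes "V \<in> S" "\<And>V'. V' \<in> S \<Longrightarrow> frob_dist d L W V \<le> frob_dist d L W V'"
  shows "set_dist d L W S = frob_dist d L W V"
  unfolding set_dist_def by (rule cInf_eq_minimum) (use assms in auto)

theorem theorem3p11:
  fixes L :: nat and d :: "nat \<Rightarrow> nat" and lam :: real and y :: "nat \<Rightarrow> real"
    and s :: "nat \<Rightarrow> real"
  assumes L2: "L \<ge> 2"
    and lam: "lam > 0"
    and ynonneg: "\<forall>i<dmin d L. y i \<ge> 0"
    and ysorted: "\<forall>i j. i \<le> j \<and> j < dmin d L \<longrightarrow> y j \<le> y i"
    and width: "\<forall>l\<in>{1..L-1}. d l \<ge> dmin d L"
    and lamL2: "L = 2 \<longrightarrow> (\<forall>i<rY d L y. lam \<noteq> (y i)\<^sup>2)"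
    and lamL3: "L \<ge> 3 \<longrightarrow> (\<forall>i<rY d L y. lam \<noteq> y i ^ (2 * (L - 1)) /
          ((real (L - 2) / real L) powr (real L / (2 * (real L - 1)))
           + (real L / real (L - 2)) powr ((real L - 2) / (2 * (real L - 1)))) ^ (2 * (L - 1)))"
    and sA: "s \<in> A_sort d L lam y"
    and snz: "\<exists>i<dmin d L. s i \<noteq> 0"
  shows "\<exists>\<epsilon> \<kappa>. \<epsilon> > 0 \<and> \<kappa> > 0 \<and>
           (\<forall>W. set_dist d L W (Wset d L lam y s) \<le> \<epsilon> \<longrightarrow>
                set_dist d L W (Wset d L lam y s) \<le> \<kappa> * gradG_norm d L lam y W)"
proof -
  define N where "N = dmin d L"
  have dN: "dmin d L \<le> d l" if "l \<le> L" for l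
  proof -
    have "l = 0 \<or> l = L \<or> l \<in> {1..L-1}" using that by auto
    then show ?thesis using width by (auto simp: dmin_def)
  qed
  have rY: "i < rY d L y \<longleftrightarrow> i < dmin d L \<and> y i > 0" for i
    using rY_iff[of d L y i] ynonneg ysorted by blast
  have r: "rY d L y \<le> d 0" "rY d L y \<le> d L"
    using rY_le[of d L y] by (auto simp: dmin_def)
  define F where "F = {p. p permutes {..<N} \<and> (\<lambda>i. s (p i)) \<in> Aset d L lam y}"
  have finF: "finite F"
    unfolding F_def by (rule finite_subset[OF _ finite_permutations[of "{..<N}"]]) auto
  define b where "b p i = (if i < N then s (p i) else 0)" for p :: "nat \<Rightarrow> nat" and i
  have "F \<noteq> {}"
  proof -
    obtain a p where a: "a \<in> Aset d L lam y" and p: "p permutes {..<N}" and sa: "\<And>i. i < N \<Longrightarrow> s i = a (p i)"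
      using sA unfolding A_sort_def N_def by auto
    \<comment> \<open>Undoing the sorting recovers \<open>a\<close> itself, so \<open>inv p\<close>
      is an admissible permutation.\<close>
    have "s (inv p i) = a i" if "i < N" for i
      using sa[of "inv p i"] permutes_in_image[OF permutes_inv[OF p], of i] that
      by (simp add: permutes_inverses[OF p])
    then have "(\<lambda>i. s (inv p i)) \<in> Aset d L lam y"
      using a by (simp add: Aset_def N_def)
    then show ?thesis using permutes_inv[OF p] by (auto simp: F_def)
  qed
  have crit: "critical_diag d L lam y (b p)" if p: "p \<in> F" for p
  proof
    have A: "b p i ^ (2 * L - 1) - sqrt lam * y i * b p i ^ (L - 1) + lam * b p i = 0 \<and> b p i \<ge> 0"
      if "i < dmin d L" for i using p that by (simp add: F_def Aset_def b_def N_def)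
    show "L \<ge> 2" "lam > 0" by (rule L2, rule lam)
    show "l \<le> L \<Longrightarrow> dmin d L \<le> d l" for l by (rule dN)
    show "i < dmin d L \<Longrightarrow> y i \<ge> 0" for i using ynonneg by blast
    show bN: "dmin d L \<le> i \<Longrightarrow> b p i = 0" for i by (simp add: b_def N_def)
    show "b p i \<ge> 0" for i using A[of i] bN[of i] by (cases "i < dmin d L") auto
    show "i < dmin d L \<Longrightarrow> b p i ^ (2 * L - 1) - sqrt lam * y i * b p i ^ (L - 1) + lam * b p i = 0" for i
      using A by blast
    show "sqrt lam * y i \<noteq> lam" if "i < dmin d L" "L = 2" for i
    proof
      assume "sqrt lam * y i = lam"
      also have "lam = sqrt lam * sqrt lam" using lam by simp
      finally have "y i = sqrt lam" using lam by (simp only: mult_cancel_left) simp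
      then show False using lamL2 that rY[of i] lam by auto
    qed
    show "real L * b p i ^ (2 * L - 2) \<noteq> lam * (real L - 2)" if pos: "b p i > 0" for i
    proof (cases "L = 2")
      case True
      then show ?thesis using pos by simp
    next
      case False
      then have L3: "L \<ge> 3" using L2 by simp
      have i: "i < dmin d L" using bN[of i] pos by (cases "i < dmin d L") auto
      \<comment> \<open>For \<open>y i = 0\<close> the defining equation would be a sum of positive
        terms. Hence \<open>i < rY d L y\<close>, the range in which the assumption on
        \<open>lam\<close> speaks.\<close>
      have "y i \<noteq> 0"
      proof
        assume "y i = 0"
        then have "b p i ^ (2 * L - 1) + lam * b p i = 0" using A[OF i] by simp
        moreover have "b p i ^ (2 * L - 1) + lam * b p i > 0"
          using pos lam by (intro add_pos_pos) auto
        ultimately show False by simp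
      qed
      then have "i < rY d L y" using rY[of i] i ynonneg by force
      then show ?thesis
        using lamL3 L3 double_root_lam[OF L3 lam pos, of "y i"] A[OF i] by blast
    qed
  qed
  \<comment> \<open>One index \<open>n\<close> governs both constants,
    \<open>\<epsilon> = 1/(n+1)\<close> and \<open>\<kappa> = n+1\<close>. The bound is therefore an
    eventual property of \<open>n\<close>, and the finitely many permutations share a common
    \<open>n\<close>.\<close>
  have "\<forall>p\<in>F. \<forall>\<^sub>F n in sequentially. \<forall>W. in_slice d L y (b p) W \<longrightarrow>
     frob_dist d L W (\<lambda>_. diagm (b p)) \<le> 1 / real (Suc n) \<longrightarrow>
     frob_dist d L W (\<lambda>_. diagm (b p)) \<le> real (Suc n) * gradG_norm d L lam y W"
    unfolding eventually_sequentially by (intro ballI critical_diag.slice_error_bound crit)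
  then have "\<forall>\<^sub>F n in sequentially. \<forall>p\<in>F. \<forall>W. in_slice d L y (b p) W \<longrightarrow>
     frob_dist d L W (\<lambda>_. diagm (b p)) \<le> 1 / real (Suc n) \<longrightarrow>
     frob_dist d L W (\<lambda>_. diagm (b p)) \<le> real (Suc n) * gradG_norm d L lam y W"
    by (rule eventually_ball_finite[OF finF])
  then obtain n where n: "\<And>p W. p \<in> F \<Longrightarrow> in_slice d L y (b p) W \<Longrightarrow>
     frob_dist d L W (\<lambda>_. diagm (b p)) \<le> 1 / real (Suc n) \<Longrightarrow>
     frob_dist d L W (\<lambda>_. diagm (b p)) \<le> real (Suc n) * gradG_norm d L lam y W"
    unfolding eventually_sequentially by blast
  have "set_dist d L W (Wset d L lam y s) \<le> real (Suc n) * gradG_norm d L lam y W"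
    if close: "set_dist d L W (Wset d L lam y s) \<le> 1 / real (Suc n)" for W
  proof -
    have "\<exists>R. R \<in> frames d L y (rY d L y) \<and> (\<forall>R'\<in>frames d L y (rY d L y).
        frob_dist d L W (act d R (\<lambda>_. diagm (b p))) \<le> frob_dist d L W (act d R' (\<lambda>_. diagm (b p))))" for p
      using nearest_frame[OF r] by metis
    then obtain Rm where Rm: "\<And>p. Rm p \<in> frames d L y (rY d L y)"
      and Rmin: "\<And>p R'. R' \<in> frames d L y (rY d L y) \<Longrightarrow>
        frob_dist d L W (act d (Rm p) (\<lambda>_. diagm (b p))) \<le> frob_dist d L W (act d R' (\<lambda>_. diagm (b p)))"
      by metis
    define D where "D p = frob_dist d L W (act d (Rm p) (\<lambda>_. diagm (b p)))" for p
    obtain p where p: "p \<in> F" and pmin: "\<And>q. q \<in> F \<Longrightarrow> D p \<le> D q"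
      using ex_min_if_finite[of "D ` F"] finF \<open>F \<noteq> {}\<close> by (force simp: not_less)
    define R where "R = Rm p"
    \<comment> \<open>The infimum is attained: compactness supplies the best frame for each
      permutation, finiteness of \<open>F\<close> the best permutation, and
      \<open>Wset_cases\<close> shows that these exhaust the set.\<close>
    have "set_dist d L W (Wset d L lam y s) = D p"
      unfolding D_def
    proof (rule set_dist_eq_minimum)
      show "act d (Rm p) (\<lambda>_. diagm (b p)) \<in> Wset d L lam y s"
        using act_in_Wset[OF L2 dN _ _ Rm, of p s lam] p by (simp add: F_def N_def b_def[abs_def])
      fix V assume "V \<in> Wset d L lam y s"
      then obtain q R' where q: "q permutes {..<dmin d L}" "(\<lambda>i. s (q i)) \<in> Aset d L lam y"
        and R': "R' \<in> frames d L y (rY d L y)"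
        and V: "\<And>l i j. 1 \<le> l \<Longrightarrow> l \<le> L \<Longrightarrow> i < d l \<Longrightarrow> j < d (l - 1) \<Longrightarrow>
          V l i j = act d R' (\<lambda>_. diagm (\<lambda>i. if i < dmin d L then s (q i) else 0)) l i j"
        by (rule Wset_cases[OF L2 dN, rotated]) blast
      have "D p \<le> D q" using pmin q by (simp add: F_def N_def)
      also have "\<dots> \<le> frob_dist d L W (act d R' (\<lambda>_. diagm (b q)))"
        unfolding D_def by (rule Rmin[OF R'])
      also have "\<dots> = frob_dist d L W V"
        by (rule frob_dist_cong) (auto simp: V b_def[abs_def] N_def)
      finally show "frob_dist d L W (act d (Rm p) (\<lambda>_. diagm (b p))) \<le> frob_dist d L W V"
        by (simp add: D_def)
    qed
    also have Dp: "D p = frob_dist d L (act d (\<lambda>l. tr (R l)) W) (\<lambda>_. diagm (b p))"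
      unfolding D_def R_def by (rule frob_dist_frame[OF frames_orth[OF Rm], symmetric])
    finally have dist: "set_dist d L W (Wset d L lam y s)
      = frob_dist d L (act d (\<lambda>l. tr (R l)) W) (\<lambda>_. diagm (b p))" .
    have "in_slice d L y (b p) (act d (\<lambda>l. tr (R l)) W)"
      unfolding R_def
      by (rule nearest_in_slice[OF L2 Rm Rmin dN]) (auto simp: b_def N_def rY)
    from n[OF p this] close
    have "set_dist d L W (Wset d L lam y s) \<le> real (Suc n) * gradG_norm d L lam y (act d (\<lambda>l. tr (R l)) W)"
      unfolding dist by simp
    also have "gradG_norm d L lam y (act d (\<lambda>l. tr (R l)) W) = gradG_norm d L lam y W"
    proof (rule gradG_norm_act)
      show "orthogonal_mat (d l) (tr (R l))" if "l \<le> L" for l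
        using frames_orth[OF Rm that] by (simp add: R_def orthogonal_mat_tr)
      have "y i = 0" if "i < dmin d L" "rY d L y \<le> i" for i
        using rY[of i] that ynonneg by force
      then show "mmul (tr (R L)) (mmul (Ymat d L y) (tr (tr (R 0))) (d 0)) (d L) i j = Ymat d L y i j"
        if "i < d L" "j < d 0" for i j
        unfolding R_def using frame_fixes_Y[OF Rm _ that] by blast
    qed
    finally show ?thesis .
  qed
  then show ?thesis
    by (intro exI[of _ "1 / real (Suc n)"] exI[of _ "real (Suc n)"]) simp
qed

end
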